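(* Let $I\subseteq[m]\times[r]$, $J\subseteq[n]\times[r]$ be such that for all $k\in\bar T$, $\mathcal{S}'_k$ is rectangular, and for all $k,l\in\bar T$ either $\mathcal{S}'_k=\mathcal{S}'_l$ or $\mathcal{S}'_k\cap\mathcal{S}'_l=\emptyset$. Then for each $A\in\mathbb{R}^{m\times n}$ the function $L(X,Y)=\|A-XY^\top\|^2$ on the feasible set has no spurious local valley.
   Context: $[p]=\{1,\dots,p\}$; $\|\cdot\|$ Frobenius norm; $\mathrm{supp}(M)=\{(i,j):M_{i,j}\ne0\}$. Feasible set: $\{(X,Y)\in\mathbb{R}^{m\times r}\times\mathbb{R}^{n\times r}:\mathrm{supp}(X)\subseteq I,\mathrm{supp}(Y)\subseteq J\}\cong\mathbb{R}^{|I|+|J|}$. Rank-one supports $\mathcal{S}_k=\{i:(i,k)\in I\}\times\{j:(j,k)\in J\}$; equivalence $k\sim l$ iff $\mathcal{S}_k=\mathcal{S}_l$; for a class $P$: $\mathcal{S}_P$ its support, $R_P=\{i:(i,k)\in I\}$, $C_P=\{j:(j,k)\in J\}$ ($k\in P$). $P$ is a complete equivalence class (CEC) if $|P|\ge\min(|R_P|,|C_P|)$; $T$ is the union of all CECs, $\bar T=[r]\setminus T$, $\mathcal{S}_T$ the union of $\mathcal{S}_P$ over CECs. For $k\in\bar T$, $\mathcal{S}'_k=\mathcal{S}_k\setminus\mathcal{S}_T$, rectangular if equal to $R_k\times C_k$ for some $R_k\subseteq[m]$, $C_k\subseteq[n]$. A local valley of $L$ is a nonempty path-connected component of a sublevel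 set $\{L\le\alpha\}$; it is spurious if it contains no global minimizer. *)

theory Defs
  imports "HOL-Analysis.Analysis"
begin

text \<open>
  Row, column and factor indices are the finite types \<open>'m\<close>, \<open>'n\<close>, \<open>'r\<close>, playing the roles of
  $[m]$, $[n]$, $[r]$. A matrix in $\mathbb{R}^{m\times r}$ has type \<open>real^'r^'m\<close>; the library
  norm of this type is the Frobenius norm.
\<close>

definition supp :: "real^'c^'d \<Rightarrow> ('d \<times> 'c) set" where
  "supp M = {(i, j). M $ i $ j \<noteq> 0}"

definition feasible ::
  "('m::finite \<times> 'r::finite) set \<Rightarrow> ('n::finite \<times> 'r) set \<Rightarrow> ((real^'r^'m) \<times> (real^'r^'n)) set" where
  "feasible I J = {(X, Y). supp X \<subseteq> I \<and> supp Y \<subseteq> J}"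

definition fact_loss :: "real^'n^'m \<Rightarrow> (real^'r^'m) \<times> (real^'r^'n) \<Rightarrow> real" where
  "fact_loss A = (\<lambda>(X, Y). (norm (A - X ** transpose Y))\<^sup>2)"

definition col_supp :: "('d \<times> 'r) set \<Rightarrow> 'r \<Rightarrow> 'd set" where
  "col_supp I k = {i. (i, k) \<in> I}"

definition rank1_supp :: "('m \<times> 'r) set \<Rightarrow> ('n \<times> 'r) set \<Rightarrow> 'r \<Rightarrow> ('m \<times> 'n) set" where
  "rank1_supp I J k = col_supp I k \<times> col_supp J k"

definition supp_rel :: "('m \<times> 'r) set \<Rightarrow> ('n \<times> 'r) set \<Rightarrow> ('r \<times> 'r) set" where
  "supp_rel I J = {(k, l). rank1_supp I J k = rank1_supp I J l}"

definition class_supp :: "('m \<times> 'r) set \<Rightarrow> ('n \<times> 'r) set \<Rightarrow> 'r set \<Rightarrow> ('m \<times> 'n) set" where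
  "class_supp I J P = (\<Union>k\<in>P. rank1_supp I J k)"

text \<open>
  The sets $R_P$ and $C_P$ are read off from a representative \<open>k \<in> P\<close>. If the class has empty
  rank-one support they may depend on \<open>k\<close>, but $\min(|R_P|, |C_P|)$ does not (it is 0), so the
  condition is independent of the representative; see \<open>is_CEC_representative\<close>.
\<close>

definition is_CEC :: "('m \<times> 'r) set \<Rightarrow> ('n \<times> 'r) set \<Rightarrow> 'r set \<Rightarrow> bool" where
  "is_CEC I J P \<longleftrightarrow> P \<in> UNIV // supp_rel I J \<and>
     (\<forall>k\<in>P. card P \<ge> min (card (col_supp I k)) (card (col_supp J k)))"

definition CEC_union :: "('m \<times> 'r) set \<Rightarrow> ('n \<times> 'r) set \<Rightarrow> 'r set" where
  "CEC_union I J = \<Union>{P. is_CEC I J P}"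

definition CEC_supp :: "('m \<times> 'r) set \<Rightarrow> ('n \<times> 'r) set \<Rightarrow> ('m \<times> 'n) set" where
  "CEC_supp I J = \<Union>{class_supp I J P | P. is_CEC I J P}"

definition reduced_supp :: "('m \<times> 'r) set \<Rightarrow> ('n \<times> 'r) set \<Rightarrow> 'r \<Rightarrow> ('m \<times> 'n) set" where
  "reduced_supp I J k = rank1_supp I J k - CEC_supp I J"

definition rectangular :: "('m \<times> 'n) set \<Rightarrow> bool" where
  "rectangular S \<longleftrightarrow> (\<exists>R C. S = R \<times> C)"

definition local_valley :: "('a::topological_space \<Rightarrow> real) \<Rightarrow> 'a set \<Rightarrow> 'a set \<Rightarrow> bool" where
  "local_valley L D V \<longleftrightarrow>
     (\<exists>\<alpha>. \<exists>x \<in> {x \<in> D. L x \<le> \<alpha>}. V = path_component_set {x \<in> D. L x \<le> \<alpha>} x)"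

definition spurious_local_valley ::
  "('a::topological_space \<Rightarrow> real) \<Rightarrow> 'a set \<Rightarrow> 'a set \<Rightarrow> bool" where
  "spurious_local_valley L D V \<longleftrightarrow>
     local_valley L D V \<and> \<not> (\<exists>x\<in>V. is_arg_min L (\<lambda>z. z \<in> D) x)"

lemma equiv_supp_rel: "equiv UNIV (supp_rel I J)"
  by (auto simp: supp_rel_def equiv_def refl_on_def sym_def trans_def)

lemma class_supp_representative:
  assumes "P \<in> UNIV // supp_rel I J" "k \<in> P"
  shows "class_supp I J P = rank1_supp I J k"
proof -
  have "rank1_supp I J l = rank1_supp I J k" if "l \<in> P" for l
    using quotient_eq_iff[OF equiv_supp_rel assms(1) assms(1) that assms(2)]
    by (simp add: supp_rel_def)
  with assms(2) show ?thesis unfolding class_supp_def by blast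
qed

lemma is_CEC_representative:
  assumes P: "P \<in> UNIV // supp_rel I J" and k: "k \<in> P"
  shows "is_CEC I J P \<longleftrightarrow> card P \<ge> min (card (col_supp I k)) (card (col_supp J k))"
proof -
  have "min (card (col_supp I l)) (card (col_supp J l))
      = min (card (col_supp I k)) (card (col_supp J k))" if l: "l \<in> P" for l
  proof -
    have "rank1_supp I J l = rank1_supp I J k"
      using class_supp_representative[OF P l] class_supp_representative[OF P k] by simp
    then have "col_supp I l \<times> col_supp J l = col_supp I k \<times> col_supp J k"
      by (simp only: rank1_supp_def)
    then consider "col_supp I l = col_supp I k" "col_supp J l = col_supp J k"
      | "col_supp I l = {} \<or> col_supp J l = {}" "col_supp I k = {} \<or> col_supp J k = {}"
      unfolding times_eq_iff by blast
    then show ?thesis by cases auto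
  qed
  with P k show ?thesis unfolding is_CEC_def by metis
qed

end

theory Submission
  imports Defs
begin

text \<open>
  The columns in complete equivalence classes can be moved, without changing the product, until
  on each class one of the two factors spans all vectors of its support. From then on every matrix
  supported on \<open>\<S>\<^sub>T\<close> can be added to the product by a linear change of the other factors only, so
  the loss on \<open>\<S>\<^sub>T\<close> can be kept at zero along any motion of the remaining columns.

  Off \<open>\<S>\<^sub>T\<close> the problem splits into independent unconstrained low-rank approximations, one for each
  distinct rectangle. Such a block is solved greedily: if \<open>e\<close> is a unit vector maximising
  \<open>|A\<^sup>T e|\<close>, product-preserving shears make one column \<open>w\<close> orthogonal to all others and all others
  orthogonal to \<open>e\<close>; moving \<open>w\<close> along a segment to \<open>\<plusminus>e\<close>, with the optimal partner column at each time,
  never raises the loss above its initial value. The matrix \<open>e e\<^sup>T A\<close> is then split off and the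
  remaining columns are treated in the same way. The final loss does not depend on the starting
  point, hence it is the global minimum.
\<close>

section \<open>Coordinate subspaces, factor pairs and descending paths\<close>

definition vec_on :: "'d set \<Rightarrow> (real^'d) set" where
  "vec_on S = {v. \<forall>i. i \<notin> S \<longrightarrow> v $ i = 0}"

lemma subspace_vec_on: "subspace (vec_on S)"
  by (auto simp: subspace_def vec_on_def)

lemma vec_on_expand:
  "v \<in> vec_on S \<Longrightarrow> (v :: real^'d) = (\<Sum>i\<in>S. v $ i *\<^sub>R axis i 1)"
  unfolding vec_eq_iff by (auto simp: vec_on_def axis_def if_distrib cong: if_cong)

lemma axis_mem_vec_on: "i \<in> S \<Longrightarrow> axis i c \<in> vec_on S"
  by (auto simp: vec_on_def axis_def)

lemma dim_vec_on: "dim (vec_on S :: (real^'d) set) \<le> card S"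
proof -
  have "vec_on S \<subseteq> span ((\<lambda>i. axis i 1 :: real^'d) ` S)"
  proof
    fix v :: "real^'d" assume "v \<in> vec_on S"
    then have "v = (\<Sum>i\<in>S. v $ i *\<^sub>R axis i 1)"
      by (rule vec_on_expand)
    also have "\<dots> \<in> span ((\<lambda>i. axis i 1 :: real^'d) ` S)"
      by (intro span_sum span_scale span_base) auto
    finally show "v \<in> span ((\<lambda>i. axis i 1 :: real^'d) ` S)" .
  qed
  then have "dim (vec_on S) \<le> card ((\<lambda>i. axis i 1 :: real^'d) ` S)"
    by (rule dim_le_card) simp
  also have "\<dots> \<le> card S"
    by (rule card_image_le) simp
  finally show ?thesis .
qed

lemma inner_vec_on_disjoint:
  assumes "u \<in> vec_on S" "v \<in> vec_on S'" "S \<inter> S' = {}"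
  shows "u \<bullet> v = 0"
  unfolding inner_vec_def
  by (rule sum.neutral) (use assms in \<open>auto simp: vec_on_def\<close>)

definition proj_on :: "'d set \<Rightarrow> real^'d \<Rightarrow> real^'d" where
  "proj_on S v = (\<chi> i. if i \<in> S then v $ i else 0)"

lemma proj_on_mem: "proj_on S v \<in> vec_on S"
  by (simp add: proj_on_def vec_on_def)

lemma inner_proj_on: "v \<in> vec_on S \<Longrightarrow> proj_on S u \<bullet> v = u \<bullet> v"
  unfolding inner_vec_def proj_on_def vec_on_def by (intro sum.cong) auto

section \<open>Rank-one matrices and their inner products\<close>

definition outer :: "real^'m \<Rightarrow> real^'n \<Rightarrow> real^'n^'m" where
  "outer u v = (\<chi> i j. u $ i * v $ j)"

lemma outer_nth: "outer u v $ i $ j = u $ i * v $ j"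
  by (simp add: outer_def)

lemma inner_outer: "A \<bullet> outer u v = (u v* A) \<bullet> v"
proof -
  have "A \<bullet> outer u v = (\<Sum>i\<in>UNIV. \<Sum>j\<in>UNIV. A $ i $ j * (u $ i * v $ j))"
    by (simp add: inner_vec_def outer_nth)
  also have "\<dots> = (\<Sum>j\<in>UNIV. \<Sum>i\<in>UNIV. A $ i $ j * (u $ i * v $ j))"
    by (rule sum.swap)
  also have "\<dots> = (u v* A) \<bullet> v"
    by (simp add: inner_vec_def vector_matrix_mult_def sum_distrib_left sum_distrib_right mult_ac)
  finally show ?thesis .
qed

lemma inner_outer_outer: "outer u v \<bullet> outer u' v' = (u \<bullet> u') * (v \<bullet> v')"
  unfolding inner_vec_def outer_nth inner_real_def sum_product
  by (intro sum.cong refl) (simp add: mult_ac)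

lemma norm_outer: "norm (outer u v) = norm u * norm v"
  by (simp add: norm_eq_sqrt_inner inner_outer_outer real_sqrt_mult)

text \<open>Supplies the algebra and the continuity of \<open>outer\<close> that all later product
  computations use.\<close>

interpretation outer: bounded_bilinear outer
proof
  show "\<exists>K. \<forall>a b. norm (outer a b) \<le> norm a * norm b * K"
    by (rule exI[of _ 1]) (simp add: norm_outer)
qed (simp_all add: outer_def vec_eq_iff algebra_simps)

section \<open>Factor pairs, sublevel sets and descending paths\<close>

text \<open>The column index is outermost, so \<open>fst z $ k\<close> and \<open>snd z $ k\<close>
  are the k-th columns of X and Y and each column carries its own support condition.\<close>

definition factors ::
  "('r \<Rightarrow> 'm set) \<Rightarrow> ('r \<Rightarrow> 'n set) \<Rightarrow> ((real^'m^'r) \<times> (real^'n^'r)) set" where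
  "factors R C = {z. \<forall>k. fst z $ k \<in> vec_on (R k) \<and> snd z $ k \<in> vec_on (C k)}"

lemma subspace_factors: "subspace (factors R C)"
  unfolding factors_def
  by (auto simp: subspace_def subspace_0[OF subspace_vec_on] subspace_add[OF subspace_vec_on]
      subspace_scale[OF subspace_vec_on])

text \<open>The share of the columns in \<open>K\<close> in the product of X with the transpose of
  Y; \<open>K = UNIV\<close> gives the whole product.\<close>

definition fprod :: "'r set \<Rightarrow> (real^'m^'r::finite) \<times> (real^'n^'r) \<Rightarrow> real^'n^'m" where
  "fprod K z = (\<Sum>k\<in>K. outer (fst z $ k) (snd z $ k))"

lemma continuous_on_fprod [continuous_intros]:
  "continuous_on S f \<Longrightarrow> continuous_on S (\<lambda>t. fprod K (f t))"
  unfolding fprod_def by (intro continuous_intros outer.continuous_on)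

text \<open>The level is the loss of \<open>z\<close> itself and the columns outside
  \<open>K\<close> are frozen at \<open>z\<close>. A path in this set may go up and down, but never
  above its starting value.\<close>

definition valley ::
  "('r::finite \<Rightarrow> 'm::finite set) \<Rightarrow> ('r \<Rightarrow> 'n::finite set) \<Rightarrow> 'r set \<Rightarrow> real^'n^'m \<Rightarrow>
   (real^'m^'r) \<times> (real^'n^'r) \<Rightarrow> ((real^'m^'r) \<times> (real^'n^'r)) set" where
  "valley R C K A z = {u \<in> factors R C.
     (\<forall>k. k \<notin> K \<longrightarrow> fst u $ k = fst z $ k \<and> snd u $ k = snd z $ k) \<and>
     norm (A - fprod K u) \<le> norm (A - fprod K z)}"

definition reach where
  "reach R C K A z z' \<longleftrightarrow> path_component (valley R C K A z) z z'"

lemma reachD: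
  assumes "reach R C K A z z'"
  shows "z \<in> factors R C" "z' \<in> factors R C" "norm (A - fprod K z') \<le> norm (A - fprod K z)"
    "k \<notin> K \<Longrightarrow> fst z' $ k = fst z $ k" "k \<notin> K \<Longrightarrow> snd z' $ k = snd z $ k"
  using path_component_mem[OF assms[unfolded reach_def]] by (auto simp: valley_def)

lemma reach_refl: "z \<in> factors R C \<Longrightarrow> reach R C K A z z"
  by (simp add: reach_def path_component_refl_eq valley_def)

text \<open>The end point of the first path has no larger loss, so its valley lies inside that of
  the start.\<close>

lemma reach_trans:
  assumes "reach R C K A z z'" "reach R C K A z' z''"
  shows "reach R C K A z z''"
proof -
  have "valley R C K A z' \<subseteq> valley R C K A z"
    using reachD[OF assms(1)] by (auto simp: valley_def)
  then have "path_component (valley R C K A z) z' z''"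
    using assms(2) path_component_of_subset unfolding reach_def by blast
  then show ?thesis
    using assms(1) path_component_trans unfolding reach_def by blast
qed

lemma path_componentI:
  fixes g :: "real \<Rightarrow> 'a::topological_space"
  assumes "continuous_on {0..1} g" "\<And>t. 0 \<le> t \<Longrightarrow> t \<le> 1 \<Longrightarrow> g t \<in> S" "g 0 = a" "g 1 = b"
  shows "path_component S a b"
  unfolding path_component_def
  by (rule exI[of _ g])
     (use assms in \<open>auto simp: path_def path_image_def pathstart_def pathfinish_def\<close>)

text \<open>The quadratic term in \<open>t\<close> is a sum of products of the two halves of a
  column of \<open>d\<close>, one of which is zero.\<close>

lemma fprod_line:
  assumes "\<And>k. k \<in> K \<Longrightarrow> fst d $ k = 0 \<or> snd d $ k = 0"
  shows "fprod K (z + t *\<^sub>R d) = fprod K z + t *\<^sub>R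
    (\<Sum>k\<in>K. outer (fst d $ k) (snd z $ k) + outer (fst z $ k) (snd d $ k))"
  unfolding fprod_def scaleR_sum_right sum.distrib[symmetric]
proof (rule sum.cong[OF refl])
  fix k assume "k \<in> K"
  with assms[of k] show "outer (fst (z + t *\<^sub>R d) $ k) (snd (z + t *\<^sub>R d) $ k) =
     outer (fst z $ k) (snd z $ k) +
     t *\<^sub>R (outer (fst d $ k) (snd z $ k) + outer (fst z $ k) (snd d $ k))"
    by (auto simp: outer.add_left outer.add_right outer.scaleR_left outer.scaleR_right
        outer.zero_left outer.zero_right scaleR_add_right)
qed

text \<open>Since the product is affine along the segment, the residual norm is convex there and
  hence bounded by its end values, the larger of which is attained at the start.\<close>

lemma reach_line:
  assumes z: "z \<in> factors R C" and d: "d \<in> factors R C"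
    and off: "\<And>k. k \<notin> K \<Longrightarrow> fst d $ k = 0 \<and> snd d $ k = 0"
    and one: "\<And>k. k \<in> K \<Longrightarrow> fst d $ k = 0 \<or> snd d $ k = 0"
    and le: "norm (A - fprod K (z + d)) \<le> norm (A - fprod K z)"
  shows "reach R C K A z (z + d)"
  unfolding reach_def
proof (rule path_componentI[where g = "\<lambda>t. z + t *\<^sub>R d"])
  fix t :: real assume t: "0 \<le> t" "t \<le> 1"
  define B where "B = (\<Sum>k\<in>K. outer (fst d $ k) (snd z $ k) + outer (fst z $ k) (snd d $ k))"
  have lin: "fprod K (z + s *\<^sub>R d) = fprod K z + s *\<^sub>R B" for s
    unfolding B_def using one by (rule fprod_line)
  have "A - fprod K (z + t *\<^sub>R d) = (1 - t) *\<^sub>R (A - fprod K z) + t *\<^sub>R (A - fprod K (z + d))"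
    using lin[of t] lin[of 1] by (simp add: algebra_simps)
  then have "norm (A - fprod K (z + t *\<^sub>R d))
      \<le> (1 - t) * norm (A - fprod K z) + t * norm (A - fprod K (z + d))"
    using norm_triangle_ineq[of "(1 - t) *\<^sub>R (A - fprod K z)" "t *\<^sub>R (A - fprod K (z + d))"] t
    by simp
  also have "\<dots> \<le> (1 - t) * norm (A - fprod K z) + t * norm (A - fprod K z)"
    using le t by (intro add_left_mono mult_left_mono) auto
  finally have "norm (A - fprod K (z + t *\<^sub>R d)) \<le> norm (A - fprod K z)"
    by (simp add: algebra_simps)
  moreover have "z + t *\<^sub>R d \<in> factors R C"
    using z d by (simp add: subspace_add[OF subspace_factors] subspace_scale[OF subspace_factors])
  ultimately show "z + t *\<^sub>R d \<in> valley R C K A z"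
    using off by (simp add: valley_def)
qed (auto intro!: continuous_intros)

section \<open>Product-preserving shears between columns of one block\<close>

text \<open>What column \<open>k\<close> loses, the sum of \<open>c l\<close> times x_l y_k^T, is
  returned by adding \<open>c l\<close> times y_k to each y_l. Each column changes on one side only,
  so the product is constant along the whole segment.\<close>

lemma reach_shear_left:
  fixes z :: "(real^'m::finite^'r::finite) \<times> (real^'n::finite^'r)"
  assumes z: "z \<in> factors R C" and k: "k \<in> K" and Q: "Q \<subseteq> K" "k \<notin> Q"
    and same: "\<And>l. l \<in> Q \<Longrightarrow> R l = R k \<and> C l = C k"
  obtains z' where "reach R C K A z z'"
    "fst z' $ k = fst z $ k - (\<Sum>l\<in>Q. c l *\<^sub>R fst z $ l)" "snd z' $ k = snd z $ k"
    "\<And>l. l \<noteq> k \<Longrightarrow> fst z' $ l = fst z $ l"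
proof -
  define dx :: "real^'m^'r" where "dx = (\<chi> l. if l = k then - (\<Sum>l\<in>Q. c l *\<^sub>R fst z $ l) else 0)"
  define dy :: "real^'n^'r" where "dy = (\<chi> l. if l \<in> Q then c l *\<^sub>R snd z $ k else 0)"
  have zm: "fst z $ l \<in> vec_on (R l)" "snd z $ l \<in> vec_on (C l)" for l
    using z by (auto simp: factors_def)
  have d: "(dx, dy) \<in> factors R C"
  proof -
    have "(\<Sum>l\<in>Q. c l *\<^sub>R fst z $ l) \<in> vec_on (R k)"
      using same zm(1) by (intro subspace_sum subspace_scale subspace_vec_on) metis
    moreover have "c l *\<^sub>R snd z $ k \<in> vec_on (C l)" if "l \<in> Q" for l
      using same[OF that] zm(2)[of k] by (simp add: subspace_scale subspace_vec_on)
    ultimately show ?thesis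
      by (auto simp: factors_def dx_def dy_def subspace_0 subspace_neg subspace_vec_on)
  qed
  have one: "fst (dx, dy) $ l = 0 \<or> snd (dx, dy) $ l = 0" for l
    using Q by (auto simp: dx_def dy_def)
  have "(\<Sum>l\<in>K. outer (dx $ l) (snd z $ l) + outer (fst z $ l) (dy $ l)) = 0"
  proof -
    have "(\<Sum>l\<in>K. outer (dx $ l) (snd z $ l)) = outer (dx $ k) (snd z $ k)"
      using k by (subst sum.mono_neutral_right[of K "{k}"]) (auto simp: dx_def outer.zero_left)
    moreover have "(\<Sum>l\<in>K. outer (fst z $ l) (dy $ l)) = (\<Sum>l\<in>Q. outer (fst z $ l) (dy $ l))"
      using Q by (intro sum.mono_neutral_right) (auto simp: dy_def outer.zero_right)
    moreover have "\<dots> = (\<Sum>l\<in>Q. outer (c l *\<^sub>R fst z $ l) (snd z $ k))"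
      by (intro sum.cong) (auto simp: dy_def outer.scaleR_left outer.scaleR_right)
    ultimately show ?thesis
      by (simp add: sum.distrib dx_def outer.minus_left outer.sum_left)
  qed
  then have "fprod K (z + (dx, dy)) = fprod K z"
    using fprod_line[of K "(dx, dy)" z 1] one by simp
  then have "reach R C K A z (z + (dx, dy))"
    using z d one k Q by (intro reach_line) (auto simp: dx_def dy_def)
  then show thesis
    by (rule that) (use Q in \<open>auto simp: dx_def dy_def\<close>)
qed

text \<open>The mirror image: each x_l loses \<open>c l\<close> times x_k, and y_k gains the sum of
  \<open>c l\<close> times y_l in compensation.\<close>

lemma reach_shear_right:
  fixes z :: "(real^'m::finite^'r::finite) \<times> (real^'n::finite^'r)"
  assumes z: "z \<in> factors R C" and k: "k \<in> K" and Q: "Q \<subseteq> K" "k \<notin> Q"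
    and same: "\<And>l. l \<in> Q \<Longrightarrow> R l = R k \<and> C l = C k"
  obtains z' where "reach R C K A z z'"
    "\<And>l. fst z' $ l = (if l \<in> Q then fst z $ l - c l *\<^sub>R fst z $ k else fst z $ l)"
proof -
  define dx :: "real^'m^'r" where "dx = (\<chi> l. if l \<in> Q then - c l *\<^sub>R fst z $ k else 0)"
  define dy :: "real^'n^'r" where "dy = (\<chi> l. if l = k then (\<Sum>l\<in>Q. c l *\<^sub>R snd z $ l) else 0)"
  have zm: "fst z $ l \<in> vec_on (R l)" "snd z $ l \<in> vec_on (C l)" for l
    using z by (auto simp: factors_def)
  have d: "(dx, dy) \<in> factors R C"
  proof -
    have "(\<Sum>l\<in>Q. c l *\<^sub>R snd z $ l) \<in> vec_on (C k)"
      using same zm(2) by (intro subspace_sum subspace_scale subspace_vec_on) metis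
    moreover have "- c l *\<^sub>R fst z $ k \<in> vec_on (R l)" if "l \<in> Q" for l
      using same[OF that] zm(1)[of k] subspace_scale[OF subspace_vec_on] by metis
    ultimately show ?thesis
      by (auto simp: factors_def dx_def dy_def subspace_0 subspace_vec_on)
  qed
  have one: "fst (dx, dy) $ l = 0 \<or> snd (dx, dy) $ l = 0" for l
    using Q by (auto simp: dx_def dy_def)
  have "(\<Sum>l\<in>K. outer (dx $ l) (snd z $ l) + outer (fst z $ l) (dy $ l)) = 0"
  proof -
    have "(\<Sum>l\<in>K. outer (fst z $ l) (dy $ l)) = outer (fst z $ k) (dy $ k)"
      using k by (subst sum.mono_neutral_right[of K "{k}"]) (auto simp: dy_def outer.zero_right)
    moreover have "(\<Sum>l\<in>K. outer (dx $ l) (snd z $ l)) = (\<Sum>l\<in>Q. outer (dx $ l) (snd z $ l))"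
      using Q by (intro sum.mono_neutral_right) (auto simp: dx_def outer.zero_left)
    moreover have "\<dots> = (\<Sum>l\<in>Q. - outer (fst z $ k) (c l *\<^sub>R snd z $ l))"
      by (intro sum.cong)
         (auto simp: dx_def outer.scaleR_left outer.scaleR_right outer.minus_left)
    ultimately show ?thesis
      by (simp add: sum.distrib dy_def outer.sum_right sum_negf)
  qed
  then have "fprod K (z + (dx, dy)) = fprod K z"
    using fprod_line[of K "(dx, dy)" z 1] one by simp
  then have "reach R C K A z (z + (dx, dy))"
    using z d one k Q by (intro reach_line) (auto simp: dx_def dy_def)
  then show thesis
    by (rule that) (use Q in \<open>auto simp: dx_def dy_def\<close>)
qed

section \<open>Isolating a column of a block\<close>

text \<open>Coefficients are indexed by \<open>S\<close> and not by the image, so that repeated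
  columns cause no trouble.\<close>

lemma span_image_explicit:
  assumes "finite S" "y \<in> span (f ` S)"
  obtains c :: "'b \<Rightarrow> real" where "y = (\<Sum>l\<in>S. c l *\<^sub>R f l)"
proof -
  let ?U = "range (\<lambda>c. \<Sum>l\<in>S. c l *\<^sub>R f l)"
  have "subspace ?U"
    unfolding subspace_def
  proof (intro conjI ballI allI)
    show "0 \<in> ?U" by (rule range_eqI[of _ _ "\<lambda>_. 0"]) simp
  next
    fix u v assume "u \<in> ?U" "v \<in> ?U"
    then obtain c d where "u = (\<Sum>l\<in>S. c l *\<^sub>R f l)" "v = (\<Sum>l\<in>S. d l *\<^sub>R f l)" by blast
    then show "u + v \<in> ?U"
      by (intro range_eqI[of _ _ "\<lambda>l. c l + d l"]) (simp add: scaleR_add_left sum.distrib)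
  next
    fix a :: real and u assume "u \<in> ?U"
    then obtain c where "u = (\<Sum>l\<in>S. c l *\<^sub>R f l)" by blast
    then show "a *\<^sub>R u \<in> ?U"
      by (intro range_eqI[of _ _ "\<lambda>l. a * c l"]) (simp add: scaleR_sum_right)
  qed
  moreover have "f ` S \<subseteq> ?U"
  proof
    fix v assume "v \<in> f ` S"
    then obtain l where "l \<in> S" "v = f l" by blast
    with assms(1) show "v \<in> ?U"
      by (intro range_eqI[of _ _ "\<lambda>i. if i = l then 1 else 0"])
         (simp add: if_distrib[of "\<lambda>a. a *\<^sub>R _"] cong: if_cong)
  qed
  ultimately have "y \<in> ?U"
    using assms(2) span_minimal by blast
  then show thesis using that by blast
qed

section \<open>Correlation with the target and updates of a single column\<close>

text \<open>The part of A^T u supported on \<open>S\<close>. Divided by the squared norm of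
  \<open>u\<close> it is the least-squares partner of \<open>u\<close> among vectors supported on
  \<open>S\<close>.\<close>

definition corr :: "real^'n^'m \<Rightarrow> 'n set \<Rightarrow> real^'m \<Rightarrow> real^'n" where
  "corr A S u = proj_on S (u v* A)"

lemma corr_mem: "corr A S u \<in> vec_on S"
  by (simp add: corr_def proj_on_mem)

lemma linear_corr: "linear (corr A S)"
  by (rule linearI)
     (simp_all add: corr_def proj_on_def vector_matrix_mult_def vec_eq_iff algebra_simps
       sum.distrib sum_distrib_left)

lemma inner_outer_corr: "v \<in> vec_on S \<Longrightarrow> A \<bullet> outer u v = corr A S u \<bullet> v"
  by (simp add: corr_def inner_proj_on inner_outer)

definition upd where
  "upd z k u v = ((\<chi> l. if l = k then u else fst z $ l), (\<chi> l. if l = k then v else snd z $ l))"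

lemma upd_nth [simp]:
  "fst (upd z k u v) $ l = (if l = k then u else fst z $ l)"
  "snd (upd z k u v) $ l = (if l = k then v else snd z $ l)"
  by (simp_all add: upd_def)

lemma upd_same: "upd z k (fst z $ k) (snd z $ k) = z"
  by (auto simp: upd_def prod_eq_iff vec_eq_iff)

lemma upd_upd [simp]: "upd (upd z k u v) k u' v' = upd z k u' v'"
  by (auto simp: upd_def vec_eq_iff)

lemma upd_mem_factors:
  "z \<in> factors R C \<Longrightarrow> u \<in> vec_on (R k) \<Longrightarrow> v \<in> vec_on (C k) \<Longrightarrow> upd z k u v \<in> factors R C"
  by (auto simp: factors_def)

lemma fprod_cong:
  "(\<And>k. k \<in> K \<Longrightarrow> fst u $ k = fst z $ k \<and> snd u $ k = snd z $ k) \<Longrightarrow> fprod K u = fprod K z"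
  by (simp add: fprod_def)

lemma fprod_upd:
  "k \<in> K \<Longrightarrow> fprod K (upd z k u v) = outer u v + fprod (K - {k}) z"
  by (simp add: fprod_def sum.remove[of K k])

lemma continuous_on_upd:
  fixes u :: "'a::topological_space \<Rightarrow> real^'m" and v :: "'a \<Rightarrow> real^'n"
  assumes "continuous_on S u" "continuous_on S v"
  shows "continuous_on S (\<lambda>t. upd z k (u t) (v t))"
proof -
  have "continuous_on S (\<lambda>t. if l = k then u t else fst z $ l)"
    "continuous_on S (\<lambda>t. if l = k then v t else snd z $ l)" for l
    using assms by (cases "l = k"; simp)+
  then show ?thesis
    unfolding upd_def by (intro continuous_on_Pair continuous_on_vec_lambda)
qed

lemma reach_upd:
  assumes z: "z \<in> factors R C" and k: "k \<in> K"
    and u: "u \<in> vec_on (R k)" and v: "v \<in> vec_on (C k)"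
    and one: "u = fst z $ k \<or> v = snd z $ k"
    and le: "norm (A - fprod K (upd z k u v)) \<le> norm (A - fprod K z)"
  shows "reach R C K A z (upd z k u v)"
proof -
  have F: "upd z k u v \<in> factors R C"
    using z u v by (rule upd_mem_factors)
  have "reach R C K A z (z + (upd z k u v - z))"
    by (rule reach_line) (use z F k one le in \<open>auto simp: subspace_diff[OF subspace_factors]\<close>)
  then show ?thesis by simp
qed

text \<open>Gaussian elimination with column \<open>k\<close> as pivot removes the
  \<open>e\<close>-components of the columns in \<open>Q\<close>; one orthogonalisation step then
  makes column \<open>k\<close> orthogonal to them.\<close>

lemma reach_isolate:
  fixes z :: "(real^'m::finite^'r::finite) \<times> (real^'n::finite^'r)"
  assumes z: "z \<in> factors R C" and k: "k \<in> K"
    and Q: "Q \<subseteq> K" "k \<notin> Q" and same: "\<And>l. l \<in> Q \<Longrightarrow> R l = R k \<and> C l = C k"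
  obtains z' where "reach R C K A z z'"
    "\<And>l. l \<in> Q \<Longrightarrow> fst z' $ l \<bullet> e = 0 \<and> fst z' $ l \<bullet> fst z' $ k = 0"
proof -
  \<comment> \<open>A nonzero pivot is secured first: if column \<open>k\<close> is orthogonal to
    \<open>e\<close> but some column of \<open>Q\<close> is not, the latter is added to column
    \<open>k\<close> (a shear with coefficient -1).\<close>
  obtain z1 where z1: "reach R C K A z z1"
    "fst z1 $ k \<bullet> e \<noteq> 0 \<or> (\<forall>l\<in>Q. fst z1 $ l \<bullet> e = 0)"
  proof (cases "fst z $ k \<bullet> e = 0 \<and> (\<exists>l\<in>Q. fst z $ l \<bullet> e \<noteq> 0)")
    case True
    then obtain l where l: "l \<in> Q" "fst z $ l \<bullet> e \<noteq> 0" "fst z $ k \<bullet> e = 0" by blast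
    obtain z1 where "reach R C K A z z1"
      "fst z1 $ k = fst z $ k - (\<Sum>i\<in>{l}. (\<lambda>_. -1) i *\<^sub>R fst z $ i)"
      by (rule reach_shear_left[of z R C k K "{l}" A "\<lambda>_. -1"]) (use z k Q same l(1) in auto)
    then show thesis
      using l by (intro that[of z1]) (auto simp: inner_add_left)
  next
    case False
    then show thesis using that[of z] reach_refl[OF z] by blast
  qed
  have F1: "z1 \<in> factors R C" using reachD(2)[OF z1(1)] .
  obtain z2 where z2: "reach R C K A z1 z2" "\<And>l. l \<in> Q \<Longrightarrow> fst z2 $ l \<bullet> e = 0"
  proof (cases "fst z1 $ k \<bullet> e = 0")
    case True
    then show thesis using that[of z1] z1(2) reach_refl[OF F1] by blast
  next
    case False
    obtain z2 where "reach R C K A z1 z2"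
      "\<And>l. fst z2 $ l = (if l \<in> Q then fst z1 $ l - ((fst z1 $ l \<bullet> e) / (fst z1 $ k \<bullet> e)) *\<^sub>R fst z1 $ k
        else fst z1 $ l)"
      by (rule reach_shear_right[of z1 R C k K Q A "\<lambda>l. (fst z1 $ l \<bullet> e) / (fst z1 $ k \<bullet> e)",
            OF F1 k Q same]) blast+
    then show thesis
      using False by (intro that[of z2]) (auto simp: inner_diff_left)
  qed
  have F2: "z2 \<in> factors R C" using reachD(2)[OF z2(1)] .
  \<comment> \<open>Subtracting from column \<open>k\<close> its projection \<open>p\<close> onto
    the span of the columns in \<open>Q\<close> leaves those columns, and their orthogonality to
    \<open>e\<close>, untouched.\<close>
  obtain p q where pq: "p \<in> span ((\<lambda>l. fst z2 $ l) ` Q)"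
    "\<And>w. w \<in> span ((\<lambda>l. fst z2 $ l) ` Q) \<Longrightarrow> orthogonal q w" "fst z2 $ k = p + q"
    by (metis orthogonal_subspace_decomp_exists)
  obtain c where c: "p = (\<Sum>l\<in>Q. c l *\<^sub>R fst z2 $ l)"
    using span_image_explicit[OF _ pq(1)] by (metis finite)
  obtain z3 where z3: "reach R C K A z2 z3"
    "fst z3 $ k = fst z2 $ k - (\<Sum>l\<in>Q. c l *\<^sub>R fst z2 $ l)"
    "\<And>l. l \<noteq> k \<Longrightarrow> fst z3 $ l = fst z2 $ l"
    by (rule reach_shear_left[of z2 R C k K Q A c, OF F2 k Q same]) blast+
  have "fst z3 $ k = q" using z3(2) c pq(3) by simp
  moreover have "fst z3 $ l = fst z2 $ l" if "l \<in> Q" for l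
    using that Q(2) z3(3)[of l] by blast
  ultimately have "fst z3 $ l \<bullet> e = 0 \<and> fst z3 $ l \<bullet> fst z3 $ k = 0" if "l \<in> Q" for l
    using that z2(2)[OF that] pq(2)[of "fst z2 $ l"]
    by (auto simp: span_base orthogonal_def inner_commute)
  moreover have "reach R C K A z z3"
    using z1(1) z2(1) z3(1) reach_trans by blast
  ultimately show thesis using that by blast
qed

text \<open>Completing the square in \<open>y\<close>: the last term is the excess over the optimal
  partner, and the first two give the minimal loss for a fixed \<open>u\<close>.\<close>

lemma norm_diff_outer:
  assumes y: "y \<in> vec_on S" and u: "u \<noteq> 0" and B: "B \<bullet> outer u y = corr A S u \<bullet> y"
  shows "(norm (B - outer u y))\<^sup>2 = (norm B)\<^sup>2 - (norm (corr A S u) / norm u)\<^sup>2 +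
    (norm (norm u *\<^sub>R y - (1 / norm u) *\<^sub>R corr A S u))\<^sup>2"
proof -
  have "(norm (B - outer u y))\<^sup>2 = (norm B)\<^sup>2 - 2 * (corr A S u \<bullet> y) + (norm u)\<^sup>2 * (norm y)\<^sup>2"
    using B by (simp add: power2_norm_eq_inner inner_diff_left inner_diff_right inner_commute
        inner_outer_outer)
  moreover have "(norm (norm u *\<^sub>R y - (1 / norm u) *\<^sub>R corr A S u))\<^sup>2
      = (norm u)\<^sup>2 * (norm y)\<^sup>2 - 2 * (corr A S u \<bullet> y) + (norm (corr A S u) / norm u)\<^sup>2"
  proof -
    have "(norm (norm u *\<^sub>R y - (1 / norm u) *\<^sub>R corr A S u))\<^sup>2
        = norm u * norm u * (y \<bullet> y) - 2 * (norm u / norm u) * (corr A S u \<bullet> y)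
          + corr A S u \<bullet> corr A S u / (norm u * norm u)"
      unfolding power2_norm_eq_inner
      by (simp add: inner_diff_left inner_diff_right inner_commute algebra_simps)
    then show ?thesis
      using u by (simp add: power2_eq_square power2_norm_eq_inner[symmetric, unfolded power2_eq_square])
  qed
  ultimately show ?thesis by simp
qed

section \<open>Greedy descent to the best approximation\<close>

text \<open>Compactness of the unit sphere of \<open>vec_on R\<close>, then homogeneity. The
  maximiser is a leading left singular vector of the block of \<open>A\<close> with rows
  \<open>R\<close> and columns \<open>C\<close>.\<close>

lemma corr_maximizer:
  fixes A :: "real^'n::finite^'m::finite"
  assumes "R \<noteq> {}"
  obtains e where "e \<in> vec_on R" "norm e = 1"
    "\<And>v. v \<in> vec_on R \<Longrightarrow> norm (corr A C v) \<le> norm (corr A C e) * norm v"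
proof -
  obtain i where i: "i \<in> R" using assms by blast
  let ?S = "sphere 0 1 \<inter> vec_on R"
  have "compact ?S"
    by (intro compact_Int_closed compact_sphere closed_subspace subspace_vec_on)
  moreover have "?S \<noteq> {}"
  proof -
    have "axis i 1 \<in> ?S"
      using axis_mem_vec_on[OF i] by (simp add: norm_axis_1)
    then show ?thesis by blast
  qed
  moreover have "continuous_on ?S (\<lambda>v. norm (corr A C v))"
    by (intro continuous_intros linear_continuous_on linear_conv_bounded_linear[THEN iffD1] linear_corr)
  ultimately obtain e where e: "e \<in> ?S" "\<And>v. v \<in> ?S \<Longrightarrow> norm (corr A C v) \<le> norm (corr A C e)"
    using continuous_attains_sup by metis
  show thesis
  proof (rule that[of e])
    fix v :: "real^'m" assume v: "v \<in> vec_on R"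
    show "norm (corr A C v) \<le> norm (corr A C e) * norm v"
    proof (cases "v = 0")
      case True
      then show ?thesis by (simp add: linear_0[OF linear_corr])
    next
      case False
      then have "(1 / norm v) *\<^sub>R v \<in> ?S"
        using v by (simp add: subspace_scale[OF subspace_vec_on])
      from e(2)[OF this] False show ?thesis
        by (simp add: linear_scale[OF linear_corr] field_simps)
    qed
  qed (use e(1) in auto)
qed

text \<open>
  With \<open>\<lambda> = |f w|\<^sup>2 / |w|\<^sup>2\<close>, the quadratic form \<open>v \<mapsto> |f v|\<^sup>2 - \<lambda> |v|\<^sup>2\<close> vanishes at \<open>w\<close> and is
  nonnegative at \<open>e\<close>; the sign \<open>s\<close> makes its mixed term nonnegative as well, hence so is the form
  on the whole segment.
\<close>

lemma rayleigh_segment: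
  fixes f :: "'a::real_inner \<Rightarrow> 'b::real_inner"
  assumes f: "linear f" and max: "norm (f w) * norm e \<le> norm (f e) * norm w" and w: "w \<noteq> 0"
  obtains s :: real where "\<bar>s\<bar> = 1"
    "\<And>t. 0 \<le> t \<Longrightarrow> t \<le> 1 \<Longrightarrow>
      norm (f w) * norm ((1 - t) *\<^sub>R w + t *\<^sub>R s *\<^sub>R e) \<le>
      norm (f ((1 - t) *\<^sub>R w + t *\<^sub>R s *\<^sub>R e)) * norm w"
proof -
  define b where "b = f w \<bullet> f e * (w \<bullet> w) - (f w \<bullet> f w) * (w \<bullet> e)"
  define s :: real where "s = (if b \<ge> 0 then 1 else -1)"
  have s: "\<bar>s\<bar> = 1" "s * b \<ge> 0" "s * s = 1" by (auto simp: s_def)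
  show thesis
  proof (rule that[OF s(1)])
    fix t :: real assume t: "0 \<le> t" "t \<le> 1"
    let ?v = "(1 - t) *\<^sub>R w + t *\<^sub>R s *\<^sub>R e"
    have "(norm (f w) * norm e)\<^sup>2 \<le> (norm (f e) * norm w)\<^sup>2"
      using max by (intro power_mono) auto
    then have e: "(f w \<bullet> f w) * (e \<bullet> e) \<le> (f e \<bullet> f e) * (w \<bullet> w)"
      by (simp add: power_mult_distrib power2_norm_eq_inner)
    have fv: "f ?v = (1 - t) *\<^sub>R f w + (t * s) *\<^sub>R f e"
      by (simp add: linear_add[OF f] linear_scale[OF f])
    have ex: "((1 - t) *\<^sub>R x + (t * s) *\<^sub>R y) \<bullet> ((1 - t) *\<^sub>R x + (t * s) *\<^sub>R y)
        = (1 - t)\<^sup>2 * (x \<bullet> x) + 2 * t * (1 - t) * s * (x \<bullet> y) + t\<^sup>2 * (y \<bullet> y)"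
      for x y :: "'c::real_inner"
    proof -
      have "((1 - t) *\<^sub>R x + (t * s) *\<^sub>R y) \<bullet> ((1 - t) *\<^sub>R x + (t * s) *\<^sub>R y)
        = (1 - t) * (1 - t) * (x \<bullet> x) + 2 * t * (1 - t) * s * (x \<bullet> y) + t * t * (s * s) * (y \<bullet> y)"
        by (simp add: inner_add_left inner_add_right inner_commute[of y x] algebra_simps)
      then show ?thesis by (simp add: s(3) power2_eq_square)
    qed
    have vv: "?v \<bullet> ?v = (1 - t)\<^sup>2 * (w \<bullet> w) + 2 * t * (1 - t) * s * (w \<bullet> e) + t\<^sup>2 * (e \<bullet> e)"
      using ex[of w e] by simp
    have ffv: "f ?v \<bullet> f ?v =
        (1 - t)\<^sup>2 * (f w \<bullet> f w) + 2 * t * (1 - t) * s * (f w \<bullet> f e) + t\<^sup>2 * (f e \<bullet> f e)"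
      unfolding fv by (rule ex)
    have "(f ?v \<bullet> f ?v) * (w \<bullet> w) - (f w \<bullet> f w) * (?v \<bullet> ?v)
        = 2 * t * (1 - t) * (s * b) + t\<^sup>2 * ((f e \<bullet> f e) * (w \<bullet> w) - (f w \<bullet> f w) * (e \<bullet> e))"
      unfolding vv ffv b_def by (simp add: algebra_simps)
    also have "\<dots> \<ge> 0"
      using s(2) e t
      by (intro add_nonneg_nonneg mult_nonneg_nonneg[of "2 * t * (1 - t)"] mult_nonneg_nonneg[of "t\<^sup>2"])
         auto
    finally have "(norm (f w) * norm ?v)\<^sup>2 \<le> (norm (f ?v) * norm w)\<^sup>2"
      by (simp add: power_mult_distrib power2_norm_eq_inner)
    then show "norm (f w) * norm ?v \<le> norm (f ?v) * norm w"
      by (rule power2_le_imp_le) simp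
  qed
qed

text \<open>Columns share a rectangle or have disjoint ones. Equality is asked of both sides, since
  shears carry multiples of columns over in either factor; disjointness of rectangles means
  disjointness of one side.\<close>

definition compat where
  "compat R C k l \<longleftrightarrow> (R k = R l \<and> C k = C l) \<or> R k \<inter> R l = {} \<or> C k \<inter> C l = {}"

text \<open>Once column \<open>k\<close> is isolated in its block, its loss depends only on a
  Rayleigh quotient of its direction, which does not fall below its initial value on the way to the
  maximiser \<open>e\<close>. The resulting rank-one term does not depend on
  \<open>z\<close>.\<close>

lemma reach_best_rank_one:
  fixes z :: "(real^'m::finite^'r::finite) \<times> (real^'n::finite^'r)" and A :: "real^'n^'m"
  assumes z: "z \<in> factors R C" and k: "k \<in> K" and compat: "\<And>l. l \<in> K \<Longrightarrow> compat R C k l"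
    and e: "e \<in> vec_on (R k)" "norm e = 1"
    and max: "\<And>v. v \<in> vec_on (R k) \<Longrightarrow> norm (corr A (C k) v) \<le> norm (corr A (C k) e) * norm v"
  obtains z' where "reach R C K A z z'" "outer (fst z' $ k) (snd z' $ k) = outer e (corr A (C k) e)"
proof -
  define Q where "Q = {l \<in> K - {k}. R l = R k \<and> C l = C k}"
  define f where "f = corr A (C k)"
  have f: "linear f" "f u \<in> vec_on (C k)" for u
    by (simp_all add: f_def linear_corr corr_mem)
  obtain z1 where z1: "reach R C K A z z1"
    "\<And>l. l \<in> Q \<Longrightarrow> fst z1 $ l \<bullet> e = 0 \<and> fst z1 $ l \<bullet> fst z1 $ k = 0"
    by (rule reach_isolate[OF z k, of Q]) (auto simp: Q_def)
  define w where "w = fst z1 $ k"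
  define B where "B = A - fprod (K - {k}) z1"
  have F1: "z1 \<in> factors R C" using reachD(2)[OF z1(1)] .
  then have w: "w \<in> vec_on (R k)" and y: "snd z1 $ k \<in> vec_on (C k)"
    by (auto simp: factors_def w_def)
  have upd: "A - fprod K (upd z1 k u v) = B - outer u v" for u v
    by (simp add: fprod_upd[OF k] B_def)
  have z1B: "A - fprod K z1 = B - outer w (snd z1 $ k)"
    using upd[of w "snd z1 $ k"] by (simp add: w_def upd_same)
  \<comment> \<open>Directions that keep column \<open>k\<close> decoupled from its block. They form
    a subspace containing both \<open>w\<close> and \<open>e\<close>, hence also every segment
    between multiples of these.\<close>
  define good where "good u \<longleftrightarrow> u \<in> vec_on (R k) \<and> (\<forall>l\<in>Q. fst z1 $ l \<bullet> u = 0)" for u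
  \<comment> \<open>The other columns are invisible here: those in \<open>Q\<close> by
    orthogonality, the rest of \<open>K\<close> by disjoint supports. Hence \<open>B\<close> pairs
    with such a product exactly as \<open>A\<close> does.\<close>
  have inner_B: "B \<bullet> outer u v = f u \<bullet> v" if u: "good u" and v: "v \<in> vec_on (C k)" for u v
  proof -
    have "outer (fst z1 $ l) (snd z1 $ l) \<bullet> outer u v = 0" if l: "l \<in> K - {k}" for l
    proof (cases "l \<in> Q")
      case True
      then show ?thesis using \<open>good u\<close> by (simp add: inner_outer_outer good_def)
    next
      case False
      then have "R l \<inter> R k = {} \<or> C l \<inter> C k = {}"
        using l compat[of l] by (auto simp: Q_def compat_def)
      moreover have "fst z1 $ l \<in> vec_on (R l)" "snd z1 $ l \<in> vec_on (C l)"
        using F1 by (auto simp: factors_def)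
      ultimately show ?thesis
        using u v inner_vec_on_disjoint[of "fst z1 $ l" "R l" u "R k"]
          inner_vec_on_disjoint[of "snd z1 $ l" "C l" v "C k"]
        unfolding inner_outer_outer good_def by auto
    qed
    then have "fprod (K - {k}) z1 \<bullet> outer u v = 0"
      unfolding fprod_def inner_sum_left by (intro sum.neutral) blast
    then show ?thesis
      using v by (simp add: B_def inner_diff_left inner_outer_corr f_def)
  qed
  have goodw: "good w" and goode: "good e"
    using z1(2) w e by (auto simp: good_def w_def)
  \<comment> \<open>The value that makes the square in \<open>norm_diff_outer\<close>
    vanish.\<close>
  define opt where "opt u = (1 / (norm u)\<^sup>2) *\<^sub>R f u" for u
  have opt: "opt u \<in> vec_on (C k)" for u
    by (simp add: opt_def f(2) subspace_scale[OF subspace_vec_on])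
  have loss_ge: "(norm B)\<^sup>2 - (norm (f u) / norm u)\<^sup>2 \<le> (norm (B - outer u v))\<^sup>2"
    if "good u" "u \<noteq> 0" "v \<in> vec_on (C k)" for u v
    using norm_diff_outer[OF that(3,2), where B = B and A = A] inner_B[OF that(1,3)] by (simp add: f_def)
  have loss_opt: "(norm (B - outer u (opt u)))\<^sup>2 = (norm B)\<^sup>2 - (norm (f u) / norm u)\<^sup>2"
    if "good u" "u \<noteq> 0" for u
    using norm_diff_outer[OF opt that(2), where B = B and A = A] inner_B[OF that(1) opt] that(2)
    by (simp add: f_def opt_def power2_eq_square)
  have "\<exists>z'. reach R C K A z1 z' \<and> outer (fst z' $ k) (snd z' $ k) = outer e (f e)"
  proof (cases "w = 0")
    case True
    let ?a = "upd z1 k 0 0" and ?b = "upd z1 k e 0" and ?c = "upd z1 k e (f e)"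
    have "B - outer w (snd z1 $ k) = B"
      by (simp add: True outer.zero_left)
    then have "reach R C K A z1 ?a"
      using F1 k by (intro reach_upd)
        (simp_all add: subspace_0[OF subspace_vec_on] upd z1B outer.zero_left True[unfolded w_def])
    moreover from this have "reach R C K A ?a (upd ?a k e 0)"
      using reachD(2) k e(1)
      by (intro reach_upd) (simp_all add: subspace_0[OF subspace_vec_on] upd outer.zero_right)
    then have "reach R C K A ?a ?b" by simp
    moreover from this have "reach R C K A ?b (upd ?b k e (f e))"
    proof (intro reach_upd)
      have "e \<noteq> 0" using e(2) by auto
      then have "(norm (B - outer e (f e)))\<^sup>2 \<le> (norm B)\<^sup>2"
        using loss_opt[OF goode] e(2) by (simp add: opt_def)
      then show "norm (A - fprod K (upd ?b k e (f e))) \<le> norm (A - fprod K ?b)"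
        unfolding upd_upd upd outer.zero_right diff_zero by (rule power2_le_imp_le) simp
    qed (use e(1) f(2) k upd_mem_factors[OF F1 e(1) subspace_0[OF subspace_vec_on]] in simp_all)
    then have "reach R C K A ?b ?c" by simp
    ultimately have "reach R C K A z1 ?c" using reach_trans by blast
    then show ?thesis by (intro exI[of _ ?c]) simp
  next
    case False
    let ?a = "upd z1 k w (opt w)"
    have "(norm (B - outer w (opt w)))\<^sup>2 \<le> (norm (B - outer w (snd z1 $ k)))\<^sup>2"
      using loss_ge[OF goodw False y] loss_opt[OF goodw False] by simp
    then have "norm (A - fprod K ?a) \<le> norm (A - fprod K z1)"
      unfolding upd z1B by (rule power2_le_imp_le) simp
    then have 1: "reach R C K A z1 ?a"
      by (intro reach_upd F1 k w opt) (simp add: w_def)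
    show ?thesis
    \<comment> \<open>If \<open>w\<close> is a multiple of \<open>e\<close>, rescaling cancels in
      the product with \<open>opt w\<close> and nothing has to move. Otherwise the segment avoids 0,
      where \<open>opt\<close> might be discontinuous.\<close>
    proof (cases "w \<in> range (\<lambda>c. c *\<^sub>R e)")
      case True
      then obtain c where c: "w = c *\<^sub>R e" by blast
      with False have "c \<noteq> 0" by auto
      have "outer w (opt w) = outer e (f e)"
        using \<open>c \<noteq> 0\<close> e(2)
        by (simp add: opt_def c linear_scale[OF f(1)] outer.scaleR_left outer.scaleR_right
            power2_eq_square)
      with 1 show ?thesis by (intro exI[of _ ?a]) simp
    next
      case npar: False
      have "norm (f w) * norm e \<le> norm (f e) * norm w"
        using max[OF w] e(2) by (simp add: f_def)
      from rayleigh_segment[OF f(1) this False] obtain s :: real where s: "\<bar>s\<bar> = 1"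
        and seg: "\<And>t. 0 \<le> t \<Longrightarrow> t \<le> 1 \<Longrightarrow> norm (f w) * norm ((1 - t) *\<^sub>R w + t *\<^sub>R s *\<^sub>R e)
            \<le> norm (f ((1 - t) *\<^sub>R w + t *\<^sub>R s *\<^sub>R e)) * norm w" by metis
      define v where "v t = (1 - t) *\<^sub>R w + t *\<^sub>R s *\<^sub>R e" for t :: real
      have v01: "v 0 = w" "v 1 = s *\<^sub>R e" by (simp_all add: v_def)
      have v0: "v t \<noteq> 0" for t
      proof
        assume "v t = 0"
        then have "(1 - t) *\<^sub>R w = - (t * s) *\<^sub>R e"
          by (simp add: v_def add_eq_0_iff)
        moreover have "t \<noteq> 1"
        proof
          assume "t = 1"
          with \<open>v t = 0\<close> v01(2) s have "e = 0" by auto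
          with e(2) show False by simp
        qed
        ultimately have "w = (- (t * s) / (1 - t)) *\<^sub>R e"
          by (metis divide_inverse_commute diff_eq_diff_eq diff_self right_inverse scaleR_one
              scaleR_scaleR eq_iff_diff_eq_0 mult.commute)
        with npar show False by blast
      qed
      have goodv: "good (v t)" for t
        using goodw goode
        by (simp add: good_def v_def inner_add_right subspace_add[OF subspace_vec_on]
            subspace_scale[OF subspace_vec_on])
      let ?b = "upd z1 k (s *\<^sub>R e) (opt (s *\<^sub>R e))"
      have "continuous_on {0..1} v" unfolding v_def by (intro continuous_intros)
      moreover from this have "continuous_on {0..1} (\<lambda>t. opt (v t))"
        unfolding opt_def using v0
        by (intro continuous_intros linear_continuous_on_compose[OF _ f(1)]) auto
      ultimately have cont: "continuous_on {0..1} (\<lambda>t. upd z1 k (v t) (opt (v t)))"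
        by (rule continuous_on_upd)
      have "reach R C K A ?a ?b"
        unfolding reach_def
      proof (rule path_componentI[OF cont])
        fix t :: real assume t: "0 \<le> t" "t \<le> 1"
        have "norm (f w) / norm w \<le> norm (f (v t)) / norm (v t)"
          using seg[OF t, folded v_def] False v0[of t] by (simp add: field_simps)
        then have "(norm (f w) / norm w)\<^sup>2 \<le> (norm (f (v t)) / norm (v t))\<^sup>2"
          by (intro power_mono) auto
        then have "(norm (B - outer (v t) (opt (v t))))\<^sup>2 \<le> (norm (B - outer w (opt w)))\<^sup>2"
          using loss_opt[OF goodv v0, of t] loss_opt[OF goodw False] by simp
        then have "norm (B - outer (v t) (opt (v t))) \<le> norm (B - outer w (opt w))"
          by (rule power2_le_imp_le) simp
        then show "upd z1 k (v t) (opt (v t)) \<in> valley R C K A ?a"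
          unfolding valley_def mem_Collect_eq upd
          using upd_mem_factors[OF F1 _ opt, of "v t"] goodv[of t] k by (auto simp: good_def)
      qed (simp_all add: v01)
      \<comment> \<open>The sign \<open>s\<close> occurs in both factors and cancels.\<close>
      moreover have "outer (s *\<^sub>R e) (opt (s *\<^sub>R e)) = outer e (f e)"
        using s e(2)
        by (cases "s = 1") (auto simp: opt_def linear_neg[OF f(1)] linear_scale[OF f(1)] outer.scaleR_left
           outer.scaleR_right abs_if outer.minus_left outer.minus_right split: if_splits)
      ultimately show ?thesis
        using reach_trans[OF 1] by (intro exI[of _ ?b]) simp
    qed
  qed
  with z1(1) that show thesis using reach_trans unfolding f_def by blast
qed

lemma reach_mono:
  assumes PK: "P \<subseteq> K" and r: "reach R C P (A - fprod (K - P) z) z z'"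
  shows "reach R C K A z z'"
proof -
  have *: "norm (A - fprod K u) = norm (A - fprod (K - P) z - fprod P u)"
    if "\<And>k. k \<notin> P \<Longrightarrow> fst u $ k = fst z $ k \<and> snd u $ k = snd z $ k" for u
  proof -
    have "fprod (K - P) u = fprod (K - P) z"
      using that by (intro fprod_cong) auto
    then show ?thesis
      using sum.subset_diff[OF PK finite, of "\<lambda>k. outer (fst u $ k) (snd u $ k)"]
      by (simp add: fprod_def diff_diff_eq)
  qed
  have "valley R C P (A - fprod (K - P) z) z \<subseteq> valley R C K A z"
  proof
    fix u assume "u \<in> valley R C P (A - fprod (K - P) z) z"
    then show "u \<in> valley R C K A z"
      using PK *[of u] *[of z] by (auto simp: valley_def)
  qed
  with r show ?thesis
    unfolding reach_def by (rule path_component_of_subset[rotated])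
qed

text \<open>Induction on the columns: when one of them has been driven to a fixed rank-one term, the
  others face the same problem for a smaller target. As \<mu> can be reached from every start
  without exceeding its loss, it is the global minimum.\<close>

lemma reach_min:
  fixes R :: "'r::finite \<Rightarrow> 'm::finite set" and C :: "'r \<Rightarrow> 'n::finite set" and A :: "real^'n^'m"
  assumes "\<And>k l. k \<in> K \<Longrightarrow> l \<in> K \<Longrightarrow> compat R C k l"
  shows "\<exists>\<mu>. \<forall>z \<in> factors R C. \<exists>z'. reach R C K A z z' \<and> norm (A - fprod K z') = \<mu>"
proof -
  have "finite K" by simp
  then show ?thesis using assms
  proof (induction K arbitrary: A)
    case empty
    then show ?case using reach_refl by (intro exI[of _ "norm A"]) (force simp: fprod_def)
  next
    case (insert k K)
    have "\<exists>D. \<forall>z \<in> factors R C. \<exists>z'. reach R C (insert k K) A z z' \<and>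
        outer (fst z' $ k) (snd z' $ k) = D"
    proof (cases "R k = {}")
      case True
      then have "outer (fst z $ k) (snd z $ k) = 0" if "z \<in> factors R C" for z
        using that by (auto simp: factors_def vec_on_def outer_def vec_eq_iff)
      then show ?thesis using reach_refl by blast
    next
      case False
      \<comment> \<open>The maximiser is fixed before the starting point, so the term
        \<open>D\<close> split off is the same for all \<open>z\<close>.\<close>
      obtain e where e: "e \<in> vec_on (R k)" "norm e = 1"
        "\<And>v. v \<in> vec_on (R k) \<Longrightarrow> norm (corr A (C k) v) \<le> norm (corr A (C k) e) * norm v"
        using corr_maximizer[OF False] by metis
      have "\<exists>z'. reach R C (insert k K) A z z' \<and>
          outer (fst z' $ k) (snd z' $ k) = outer e (corr A (C k) e)"
        if "z \<in> factors R C" for z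
      proof (rule reach_best_rank_one[OF that insertI1[of k K] _ e])
        show "compat R C k l" if "l \<in> insert k K" for l
          using insert.prems[OF insertI1 that] .
      next
        fix z' assume "reach R C (insert k K) A z z'"
          "outer (fst z' $ k) (snd z' $ k) = outer e (corr A (C k) e)"
        then show ?thesis by (intro exI[of _ z'] conjI)
      qed
      then show ?thesis by blast
    qed
    then obtain D where D: "\<And>z. z \<in> factors R C \<Longrightarrow> \<exists>z'. reach R C (insert k K) A z z' \<and>
        outer (fst z' $ k) (snd z' $ k) = D" by blast
    obtain \<mu> where \<mu>: "\<And>z. z \<in> factors R C \<Longrightarrow>
        \<exists>z'. reach R C K (A - D) z z' \<and> norm (A - D - fprod K z') = \<mu>"
    proof -
      have "\<exists>\<mu>. \<forall>z \<in> factors R C. \<exists>z'. reach R C K (A - D) z z' \<and> norm (A - D - fprod K z') = \<mu>"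
        by (rule insert.IH) (rule insert.prems; rule insertI2)
      then show thesis using that by blast
    qed
    have "\<exists>z'. reach R C (insert k K) A z z' \<and> norm (A - fprod (insert k K) z') = \<mu>"
      if z: "z \<in> factors R C" for z
    proof -
      obtain z1 where z1: "reach R C (insert k K) A z z1" "outer (fst z1 $ k) (snd z1 $ k) = D"
        using D[OF z] by blast
      obtain z2 where z2: "reach R C K (A - D) z1 z2" "norm (A - D - fprod K z2) = \<mu>"
        using \<mu>[OF reachD(2)[OF z1(1)]] by blast
      \<comment> \<open>Column \<open>k\<close> now stays frozen, so a descent for
        \<open>A - D\<close> on \<open>K\<close> is one for \<open>A\<close> on
        \<open>insert k K\<close>.\<close>
      have "insert k K - K = {k}" using insert.hyps(2) by auto
      then have "fprod (insert k K - K) z1 = D" by (simp add: fprod_def z1(2))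
      then have "reach R C (insert k K) A z1 z2"
        using z2(1) by (intro reach_mono[OF subset_insertI]) simp
      moreover have "fprod (insert k K) z2 = D + fprod K z2"
        using insert.hyps reachD(4,5)[OF z2(1), of k] z1(2) by (simp add: fprod_def)
      ultimately show ?thesis
        using reach_trans[OF z1(1)] z2(2) by (metis diff_diff_eq)
    qed
    then show ?case by blast
  qed
qed

section \<open>Spanning factors on complete classes\<close>

text \<open>If no member were redundant, \<open>f\<close> would be injective with independent image,
  and the dimension would equal \<open>card P\<close>.\<close>

lemma dim_less_card_imp_redundant:
  fixes f :: "'i \<Rightarrow> 'a::euclidean_space"
  assumes "finite P" "dim (f ` P) < card P"
  obtains k where "k \<in> P" "f k \<in> span (f ` (P - {k}))"
proof -
  have "\<exists>k\<in>P. f k \<in> span (f ` (P - {k}))"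
  proof (rule ccontr)
    assume "\<not> ?thesis"
    then have nspan: "f k \<notin> span (f ` (P - {k}))" if "k \<in> P" for k
      using that by blast
    have inj: "inj_on f P"
    proof (rule inj_onI, rule ccontr)
      fix k l assume kl: "k \<in> P" "l \<in> P" "f k = f l" "k \<noteq> l"
      then have "f k \<in> f ` (P - {k})" by auto
      then have "f k \<in> span (f ` (P - {k}))" by (rule span_base)
      with nspan[OF kl(1)] show False by blast
    qed
    have "independent (f ` P)"
      unfolding dependent_def
    proof
      assume "\<exists>a\<in>f ` P. a \<in> span (f ` P - {a})"
      then obtain k where k: "k \<in> P" "f k \<in> span (f ` P - {f k})" by blast
      have "f ` P - {f k} \<subseteq> f ` (P - {k})" by auto
      from span_mono[OF this] k(2) nspan[OF k(1)] show False by blast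
    qed
    then have "dim (f ` P) = card P"
      using card_image[OF inj] dim_eq_card_independent by metis
    with assms(2) show False by simp
  qed
  with that show thesis by blast
qed

text \<open>As long as the columns do not span, there are more of them than the dimension of their
  span, so one is redundant. A shear turns it into 0, and it can then be replaced by a missing
  vector without changing the product.\<close>

lemma reach_span:
  fixes z :: "(real^'m::finite^'r::finite) \<times> (real^'n::finite^'r)"
  assumes "z \<in> factors R C" and P: "\<And>k. k \<in> P \<Longrightarrow> R k = S \<and> C k = S'" and card: "card S \<le> card P"
  shows "\<exists>z'. reach R C P A z z' \<and> vec_on S \<subseteq> span ((\<lambda>k. fst z' $ k) ` P)"
  using assms(1)
proof (induction "card S - dim ((\<lambda>k. fst z $ k) ` P)" arbitrary: z rule: less_induct)
  case less
  define U where "U = (\<lambda>z :: (real^'m^'r) \<times> (real^'n^'r). span ((\<lambda>k. fst z $ k) ` P))"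
  have U_sub: "U z \<subseteq> vec_on S" if "z \<in> factors R C" for z
    unfolding U_def
    by (rule span_minimal[OF _ subspace_vec_on]) (use that P in \<open>auto simp: factors_def\<close>)
  show ?case
  proof (cases "vec_on S \<subseteq> U z")
    case True
    then show ?thesis using reach_refl[OF less.prems] unfolding U_def by blast
  next
    case False
    then obtain u where u: "u \<in> vec_on S" "u \<notin> U z" by blast
    have "U z \<subset> vec_on S" using False U_sub[OF less.prems] by blast
    then have "dim (U z) < dim (vec_on S :: (real^'m) set)"
      using dim_psubset[of "U z" "vec_on S :: (real^'m) set"]
        span_eq_iff[THEN iffD2, OF subspace_vec_on[of S]]
      by (simp add: U_def span_span)
    then have "dim ((\<lambda>k. fst z $ k) ` P) < card P"
      using dim_vec_on[of S] card by (simp add: U_def)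
    then obtain k where k: "k \<in> P" "fst z $ k \<in> span ((\<lambda>k. fst z $ k) ` (P - {k}))"
      using dim_less_card_imp_redundant[of P "\<lambda>k. fst z $ k"] finite by blast
    obtain c where c: "fst z $ k = (\<Sum>l\<in>P - {k}. c l *\<^sub>R fst z $ l)"
      using span_image_explicit[OF _ k(2)] by (metis finite)
    obtain z1 where z1: "reach R C P A z z1"
      "fst z1 $ k = fst z $ k - (\<Sum>l\<in>P - {k}. c l *\<^sub>R fst z $ l)"
      "\<And>l. l \<noteq> k \<Longrightarrow> fst z1 $ l = fst z $ l"
      by (rule reach_shear_left[OF less.prems k(1), of "P - {k}" A c]) (use P k(1) in auto)
    have F1: "z1 \<in> factors R C" using reachD(2)[OF z1(1)] .
    have z1k: "upd z1 k 0 (snd z1 $ k) = z1"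
      using upd_same[of z1 k] z1(2) c by simp
    \<comment> \<open>The left column is 0 now, so its partner may be set to 0; a zero partner in
      turn leaves the choice of \<open>u\<close> free.\<close>
    let ?a = "upd z1 k 0 0" and ?b = "upd z1 k u 0"
    have Fa: "?a \<in> factors R C" and Fb: "?b \<in> factors R C"
      using F1 P[OF k(1)] u(1) by (simp_all add: upd_mem_factors subspace_0[OF subspace_vec_on])
    have eq: "fprod P (upd z1 k 0 v) = fprod P (upd z1 k u 0)" for v
      by (simp add: fprod_upd[OF k(1)] outer.zero_left outer.zero_right)
    have "reach R C P A z1 ?a"
      using eq[of "snd z1 $ k"] eq[of 0] F1 k(1)
      by (intro reach_upd) (simp_all add: z1k subspace_0[OF subspace_vec_on] z1(2) c)
    moreover have "reach R C P A ?a (upd ?a k u 0)"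
      by (rule reach_upd[OF Fa k(1)])
         (use eq[of 0] u(1) P[OF k(1)] in \<open>simp_all add: subspace_0[OF subspace_vec_on]\<close>)
    ultimately have r: "reach R C P A z ?b"
      using z1(1) reach_trans unfolding upd_upd by blast
    have "u \<in> U ?b"
      using k(1) unfolding U_def by (intro span_base) (auto intro!: image_eqI[of _ _ k])
    \<comment> \<open>The old column \<open>k\<close> was a combination of these, so the span loses
      nothing while it gains \<open>u\<close>.\<close>
    have rest: "fst z $ l \<in> U ?b" if "l \<in> P - {k}" for l
      using that z1(3)[of l] unfolding U_def by (intro span_base) (auto intro!: image_eqI[of _ _ l])
    moreover have "fst z $ k \<in> U ?b"
      unfolding c using rest unfolding U_def by (intro span_sum span_scale) blast
    ultimately have "(\<lambda>k. fst z $ k) ` P \<subseteq> U ?b" by blast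
    then have "U z \<subseteq> U ?b"
      unfolding U_def by (intro span_minimal) auto
    then have "U z \<subset> U ?b" using u(2) \<open>u \<in> U ?b\<close> by blast
    then have "dim ((\<lambda>k. fst z $ k) ` P) < dim ((\<lambda>k. fst ?b $ k) ` P)"
      unfolding U_def by (rule dim_psubset)
    \<comment> \<open>This bound makes the truncated subtraction in the induction measure strictly
      decrease.\<close>
    moreover have "dim (U ?b) \<le> card S"
      using dim_subset[OF U_sub[OF Fb]] dim_vec_on[of S] by simp
    ultimately have "card S - dim ((\<lambda>k. fst ?b $ k) ` P) < card S - dim ((\<lambda>k. fst z $ k) ` P)"
      by (simp add: U_def)
    from less.hyps[OF this Fb] show ?thesis
      using reach_trans[OF r] by blast
  qed
qed

section \<open>Images of paths and the symmetry under transposition\<close>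

lemma path_component_image:
  assumes "path_component S a b" "continuous_on S f" "f ` S \<subseteq> T"
  shows "path_component T (f a) (f b)"
proof -
  obtain g where g: "path g" "path_image g \<subseteq> S" "pathstart g = a" "pathfinish g = b"
    using assms(1) unfolding path_component_def by blast
  have "path (f \<circ> g)"
    using g assms(2) by (intro path_continuous_image) (auto intro: continuous_on_subset)
  moreover have "path_image (f \<circ> g) \<subseteq> T"
    using g(2) assms(3) by (auto simp: path_image_compose)
  ultimately show ?thesis
    unfolding path_component_def using g(3,4)
    by (intro exI[of _ "f \<circ> g"]) (simp add: pathstart_compose pathfinish_compose)
qed

lemma norm_transpose: "norm (transpose M :: real^'m^'n) = norm (M :: real^'n^'m)"
proof -
  have "transpose M \<bullet> transpose M = M \<bullet> M"
    unfolding inner_vec_def by (subst sum.swap) (simp add: transpose_def inner_vec_def)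
  then show ?thesis by (simp add: norm_eq_sqrt_inner)
qed

lemma fprod_nth: "fprod K z $ i $ j = (\<Sum>k\<in>K. fst z $ k $ i * snd z $ k $ j)"
  by (simp add: fprod_def outer_nth)

lemma fprod_swap: "fprod K (prod.swap z) = transpose (fprod K z)"
  by (simp add: vec_eq_iff fprod_nth transpose_def) (simp add: mult.commute)

lemma reach_swap:
  assumes "reach R C K A z z'"
  shows "reach C R K (transpose A) (prod.swap z) (prod.swap z')"
  unfolding reach_def
proof (rule path_component_image[OF assms[unfolded reach_def]])
  show "continuous_on (valley R C K A z) prod.swap"
    by (intro continuous_intros continuous_on_swap)
  have "norm (transpose A - fprod K (prod.swap u)) = norm (A - fprod K u)" for u
  proof -
    have "transpose A - fprod K (prod.swap u) = transpose (A - fprod K u)"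
      by (simp add: fprod_swap transpose_def vec_eq_iff)
    then show ?thesis by (simp only: norm_transpose)
  qed
  then show "prod.swap ` valley R C K A z \<subseteq> valley C R K (transpose A) (prod.swap z)"
    by (auto simp: valley_def factors_def)
qed

text \<open>Quantifying over all \<open>k\<close> in the class avoids a representative; in the
  classes considered \<open>R k\<close> is constant.\<close>

definition spans_left where
  "spans_left R P z \<longleftrightarrow> (\<forall>k\<in>P. vec_on (R k) \<subseteq> span ((\<lambda>l. fst z $ l) ` P))"

definition spans_right where
  "spans_right C P z \<longleftrightarrow> (\<forall>k\<in>P. vec_on (C k) \<subseteq> span ((\<lambda>l. snd z $ l) ` P))"

text \<open>The minimum in the completeness condition decides which factor has enough columns to
  span; the right-hand case is the left-hand one for the transposed problem.\<close>

lemma reach_spans: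
  fixes z :: "(real^'m::finite^'r::finite) \<times> (real^'n::finite^'r)"
  assumes z: "z \<in> factors R C" and P: "\<And>k l. k \<in> P \<Longrightarrow> l \<in> P \<Longrightarrow> R k = R l \<and> C k = C l"
    and card: "\<And>k. k \<in> P \<Longrightarrow> min (card (R k)) (card (C k)) \<le> card P"
  shows "\<exists>z'. reach R C P A z z' \<and> (spans_left R P z' \<or> spans_right C P z')"
proof (cases "P = {}")
  case True
  then show ?thesis using reach_refl[OF z] by (intro exI[of _ z]) (simp add: spans_left_def)
next
  case False
  then obtain k where k: "k \<in> P" by blast
  have RC: "R l = R k \<and> C l = C k" if "l \<in> P" for l
    using P[OF that k] .
  consider "card (R k) \<le> card P" | "card (C k) \<le> card P"
    using card[OF k] by linarith
  then show ?thesis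
  proof cases
    case 1
    obtain z' where "reach R C P A z z'" "vec_on (R k) \<subseteq> span ((\<lambda>k. fst z' $ k) ` P)"
      using reach_span[OF z RC 1] by blast
    then show ?thesis using RC by (intro exI[of _ z']) (auto simp: spans_left_def)
  next
    case 2
    have "prod.swap z \<in> factors C R" using z by (auto simp: factors_def)
    from reach_span[OF this _ 2, of "R k" "transpose A"] RC
    obtain z' where z': "reach C R P (transpose A) (prod.swap z) z'"
      "vec_on (C k) \<subseteq> span ((\<lambda>k. fst z' $ k) ` P)" by blast
    have "reach R C P A z (prod.swap z')"
      using reach_swap[OF z'(1)] by (simp add: transpose_transpose)
    then show ?thesis
      using RC z'(2) by (intro exI[of _ "prod.swap z'"]) (auto simp: spans_right_def)
  qed
qed

text \<open>Classes are treated one at a time; by disjointness a later move does not touch the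
  columns of the earlier ones.\<close>

lemma reach_spans_all:
  fixes z :: "(real^'m::finite^'r::finite) \<times> (real^'n::finite^'r)"
  assumes z: "z \<in> factors R C" and disj: "disjoint \<P>"
    and P: "\<And>P k l. P \<in> \<P> \<Longrightarrow> k \<in> P \<Longrightarrow> l \<in> P \<Longrightarrow> R k = R l \<and> C k = C l"
    and card: "\<And>P k. P \<in> \<P> \<Longrightarrow> k \<in> P \<Longrightarrow> min (card (R k)) (card (C k)) \<le> card P"
  shows "\<exists>z'. reach R C UNIV A z z' \<and> (\<forall>P\<in>\<P>. spans_left R P z' \<or> spans_right C P z')"
proof -
  have "finite \<P>" by simp
  then show ?thesis using disj P card
  proof (induction \<P>)
    case empty
    then show ?case using reach_refl[OF z] by (intro exI[of _ z]) simp
  next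
    case (insert P \<P>)
    have "disjoint \<P>" using insert.prems(1) by (auto simp: pairwise_insert)
    then obtain z1 where z1: "reach R C UNIV A z z1"
      "\<forall>P\<in>\<P>. spans_left R P z1 \<or> spans_right C P z1"
      using insert.IH insert.prems(2,3) by (metis insertI2)
    obtain z2 where z2: "reach R C P (A - fprod (UNIV - P) z1) z1 z2"
      "spans_left R P z2 \<or> spans_right C P z2"
      using reach_spans[OF reachD(2)[OF z1(1)], of P "A - fprod (UNIV - P) z1"]
        insert.prems(2,3)[OF insertI1] by blast
    have "spans_left R Q z2 \<or> spans_right C Q z2" if Q: "Q \<in> \<P>" for Q
    proof -
      have "Q \<inter> P = {}"
        using insert.prems(1) insert.hyps(2) Q by (auto simp: disjoint_def)
      then have "fst z2 $ k = fst z1 $ k" "snd z2 $ k = snd z1 $ k" if "k \<in> Q" for k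
        using reachD(4,5)[OF z2(1), of k] that by auto
      then have "(\<lambda>l. fst z2 $ l) ` Q = (\<lambda>l. fst z1 $ l) ` Q"
        "(\<lambda>l. snd z2 $ l) ` Q = (\<lambda>l. snd z1 $ l) ` Q" by auto
      then show ?thesis using z1(2) Q by (simp add: spans_left_def spans_right_def)
    qed
    moreover have "reach R C UNIV A z z2"
      using reach_trans[OF z1(1) reach_mono[OF subset_UNIV z2(1)]] .
    ultimately show ?case using z2(2) by blast
  qed
qed

section \<open>Compensating on the support of the complete classes\<close>

text \<open>The derivative of \<open>fprod UNIV\<close> at \<open>z\<close>. If every column of
  \<open>d\<close> vanishes on one side, \<open>fprod_line\<close> makes the first-order expansion
  exact.\<close>

definition fprod_deriv where
  "fprod_deriv z d = (\<Sum>k\<in>UNIV. outer (fst d $ k) (snd z $ k) + outer (fst z $ k) (snd d $ k))"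

lemma linear_fprod_deriv: "linear (fprod_deriv z)"
proof (rule linearI)
  show "fprod_deriv z (d + d') = fprod_deriv z d + fprod_deriv z d'" for d d'
    unfolding fprod_deriv_def sum.distrib[symmetric]
    by (rule sum.cong) (simp_all add: outer.add_left outer.add_right)
  show "fprod_deriv z (c *\<^sub>R d) = c *\<^sub>R fprod_deriv z d" for c d
    unfolding fprod_deriv_def scaleR_sum_right
    by (rule sum.cong) (simp_all add: outer.scaleR_left outer.scaleR_right scaleR_add_right)
qed

text \<open>On a class whose left columns span, a matrix unit is produced by expanding its row
  vector in these columns and changing only the right ones; otherwise the sides are exchanged.
  Linear extension gives \<open>\<psi>\<close>.\<close>

lemma fprod_deriv_right_inverse:
  fixes z :: "(real^'m::finite^'r::finite) \<times> (real^'n::finite^'r)"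
  assumes disj: "disjoint \<P>"
    and P: "\<And>P k l. P \<in> \<P> \<Longrightarrow> k \<in> P \<Longrightarrow> l \<in> P \<Longrightarrow> R k = R l \<and> C k = C l"
    and spans: "\<And>P. P \<in> \<P> \<Longrightarrow> spans_left R P z \<or> spans_right C P z"
  obtains \<psi> :: "real^'n^'m \<Rightarrow> (real^'m^'r) \<times> (real^'n^'r)" where "linear \<psi>"
    "\<And>M. \<psi> M \<in> factors R C"
    "\<And>M k. k \<notin> \<Union>\<P> \<Longrightarrow> fst (\<psi> M) $ k = 0 \<and> snd (\<psi> M) $ k = 0"
    "\<And>M k. fst (\<psi> M) $ k = 0 \<or> snd (\<psi> M) $ k = 0"
    "\<And>M. (\<And>i j. (i, j) \<notin> (\<Union>k\<in>\<Union>\<P>. R k \<times> C k) \<Longrightarrow> M $ i $ j = 0) \<Longrightarrow> fprod_deriv z (\<psi> M) = M"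
proof -
  define \<Sigma> where "\<Sigma> = (\<Union>k\<in>\<Union>\<P>. R k \<times> C k)"
  \<comment> \<open>Fixes one moving side per column, the right one when the left columns span, so
    that sums of directions still vanish on the other side.\<close>
  define G where "G = {k. \<exists>P\<in>\<P>. k \<in> P \<and> spans_left R P z}"
  define T where "T = {d \<in> factors R C. \<forall>k. (k \<notin> \<Union>\<P> \<longrightarrow> fst d $ k = 0 \<and> snd d $ k = 0) \<and>
    (k \<in> G \<longrightarrow> fst d $ k = 0) \<and> (k \<notin> G \<longrightarrow> snd d $ k = 0)}"
  have sub: "subspace T"
    using subspace_factors[of R C] by (auto simp: T_def subspace_def)
  have "\<exists>d\<in>T. fprod_deriv z d = outer (axis i 1) (axis j 1)" if ij: "(i, j) \<in> \<Sigma>" for i j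
  proof -
    obtain P k where Pk: "P \<in> \<P>" "k \<in> P" "i \<in> R k" "j \<in> C k"
      using ij by (auto simp: \<Sigma>_def)
    have RC: "R l = R k \<and> C l = C k" if "l \<in> P" for l
      using P[OF Pk(1) that Pk(2)] .
    have G: "l \<in> G \<longleftrightarrow> spans_left R P z" if "l \<in> P" for l
    proof
      assume "l \<in> G"
      then obtain Q where Q: "Q \<in> \<P>" "l \<in> Q" "spans_left R Q z" by (auto simp: G_def)
      have "Q = P" using disjointD[OF disj Q(1) Pk(1)] Q(2) that by blast
      then show "spans_left R P z" using Q(3) by simp
    qed (use that Pk(1) in \<open>auto simp: G_def\<close>)
    have i: "axis i 1 \<in> vec_on (R k)" and j: "axis j 1 \<in> vec_on (C k)"
      using Pk(3,4) by (auto intro: axis_mem_vec_on)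
    show ?thesis
    proof (cases "spans_left R P z")
      case True
      then have "axis i 1 \<in> span ((\<lambda>l. fst z $ l) ` P)"
        using i Pk(2) unfolding spans_left_def by blast
      then obtain c where c: "axis i 1 = (\<Sum>l\<in>P. c l *\<^sub>R fst z $ l)"
        by (rule span_image_explicit[OF finite])
      define d :: "(real^'m^'r) \<times> (real^'n^'r)"
        where "d = (0, \<chi> l. if l \<in> P then c l *\<^sub>R axis j 1 else 0)"
      have "d \<in> T"
        using True RC Pk(1) subspace_scale[OF subspace_vec_on j] G
        by (auto simp: T_def d_def factors_def subspace_0[OF subspace_vec_on])
      moreover have "fprod_deriv z d = (\<Sum>l\<in>P. outer (fst z $ l) (c l *\<^sub>R axis j 1))"
        unfolding fprod_deriv_def
        by (rule sum.mono_neutral_cong_right) (auto simp: d_def outer.zero_left outer.zero_right)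
      then have "fprod_deriv z d = outer (axis i 1) (axis j 1)"
        by (simp add: c outer.sum_left outer.scaleR_left outer.scaleR_right)
      ultimately show ?thesis by blast
    next
      case False
      then have "spans_right C P z" using spans[OF Pk(1)] by blast
      then have "axis j 1 \<in> span ((\<lambda>l. snd z $ l) ` P)"
        using j Pk(2) unfolding spans_right_def by blast
      then obtain c where c: "axis j 1 = (\<Sum>l\<in>P. c l *\<^sub>R snd z $ l)"
        by (rule span_image_explicit[OF finite])
      define d :: "(real^'m^'r) \<times> (real^'n^'r)"
        where "d = (\<chi> l. if l \<in> P then c l *\<^sub>R axis i 1 else 0, 0)"
      have "d \<in> T"
        using False RC Pk(1) subspace_scale[OF subspace_vec_on i] G
        by (auto simp: T_def d_def factors_def subspace_0[OF subspace_vec_on])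
      moreover have "fprod_deriv z d = (\<Sum>l\<in>P. outer (c l *\<^sub>R axis i 1) (snd z $ l))"
        unfolding fprod_deriv_def
        by (rule sum.mono_neutral_cong_right) (auto simp: d_def outer.zero_left outer.zero_right)
      then have "fprod_deriv z d = outer (axis i 1) (axis j 1)"
        by (simp add: c outer.sum_right outer.scaleR_left outer.scaleR_right)
      ultimately show ?thesis by blast
    qed
  qed
  then have "\<forall>p\<in>\<Sigma>. \<exists>d. d \<in> T \<and> fprod_deriv z d = outer (axis (fst p) 1) (axis (snd p) 1)"
    by force
  then obtain D where D: "\<And>p. p \<in> \<Sigma> \<Longrightarrow> D p \<in> T"
    "\<And>p. p \<in> \<Sigma> \<Longrightarrow> fprod_deriv z (D p) = outer (axis (fst p) 1) (axis (snd p) 1)"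
    by metis
  define \<psi> where "\<psi> M = (\<Sum>p\<in>\<Sigma>. M $ fst p $ snd p *\<^sub>R D p)" for M :: "real^'n^'m"
  have \<psi>T: "\<psi> M \<in> T" for M
    unfolding \<psi>_def using D(1) by (intro subspace_sum subspace_scale sub)
  show thesis
  proof (rule that[of \<psi>])
    show "linear \<psi>"
      by (rule linearI) (simp_all add: \<psi>_def scaleR_add_left sum.distrib scaleR_sum_right)
    fix M :: "real^'n^'m"
    assume M: "\<And>i j. (i, j) \<notin> (\<Union>k\<in>\<Union>\<P>. R k \<times> C k) \<Longrightarrow> M $ i $ j = 0"
    have "fprod_deriv z (\<psi> M) = (\<Sum>p\<in>\<Sigma>. M $ fst p $ snd p *\<^sub>R outer (axis (fst p) 1) (axis (snd p) 1))"
      by (simp add: \<psi>_def linear_sum[OF linear_fprod_deriv] linear_scale[OF linear_fprod_deriv] D(2))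
    also have "\<dots> = M"
    proof (simp only: vec_eq_iff, intro allI)
      fix i j
      have "(\<Sum>p\<in>\<Sigma>. M $ fst p $ snd p *\<^sub>R outer (axis (fst p) 1) (axis (snd p) 1)) $ i $ j
          = (\<Sum>p\<in>\<Sigma>. if p = (i, j) then M $ i $ j else 0)"
        unfolding sum_component by (intro sum.cong refl) (auto simp: outer_nth axis_def)
      also have "\<dots> = M $ i $ j"
        using M[of i j] by (simp add: \<Sigma>_def)
      finally show "(\<Sum>p\<in>\<Sigma>. M $ fst p $ snd p *\<^sub>R outer (axis (fst p) 1) (axis (snd p) 1)) $ i $ j
          = M $ i $ j" .
    qed
    finally show "fprod_deriv z (\<psi> M) = M" .
  qed (use \<psi>T in \<open>auto simp: T_def\<close>)
qed

section \<open>Splitting the residual along the support of the complete classes\<close>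

definition restr :: "('m \<times> 'n) set \<Rightarrow> real^'n^'m \<Rightarrow> real^'n^'m" where
  "restr S M = (\<chi> i j. if (i, j) \<in> S then M $ i $ j else 0)"

lemma restr_nth: "restr S M $ i $ j = (if (i, j) \<in> S then M $ i $ j else 0)"
  by (simp add: restr_def)

lemma linear_restr: "linear (restr S)"
  by (rule linearI) (simp_all add: vec_eq_iff restr_nth)

lemma norm_restr_le: "norm (restr S M) \<le> norm M"
proof (rule norm_le_componentwise_cart, rule norm_le_componentwise_cart)
  show "norm (restr S M $ i $ j) \<le> norm (M $ i $ j)" for i j
    by (simp add: restr_nth)
qed

text \<open>On the support of the complete classes the residual can be held at zero by compensation;
  off it only the reduced rectangles \<open>R'\<close>, \<open>C'\<close> matter, and
  \<open>reach_min\<close> gives a final value common to all starts.\<close>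

lemma reach_common_value:
  fixes R R' :: "'r::finite \<Rightarrow> 'm::finite set" and C C' :: "'r \<Rightarrow> 'n::finite set" and A :: "real^'n^'m"
  assumes disj: "disjoint \<P>"
    and P: "\<And>P k l. P \<in> \<P> \<Longrightarrow> k \<in> P \<Longrightarrow> l \<in> P \<Longrightarrow> R k = R l \<and> C k = C l"
    and card: "\<And>P k. P \<in> \<P> \<Longrightarrow> k \<in> P \<Longrightarrow> min (card (R k)) (card (C k)) \<le> card P"
    and sub: "\<And>k. R' k \<subseteq> R k" "\<And>k. C' k \<subseteq> C k"
    and same: "\<And>k. k \<in> \<Union>\<P> \<Longrightarrow> R' k = R k \<and> C' k = C k"
    and rect: "\<And>k. k \<notin> \<Union>\<P> \<Longrightarrow> R' k \<times> C' k = R k \<times> C k - (\<Union>k\<in>\<Union>\<P>. R k \<times> C k)"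
    and compat: "\<And>k l. k \<notin> \<Union>\<P> \<Longrightarrow> l \<notin> \<Union>\<P> \<Longrightarrow> compat R' C' k l"
  shows "\<exists>\<mu>. \<forall>z \<in> factors R C. \<exists>z'. reach R C UNIV A z z' \<and> norm (A - fprod UNIV z') = \<mu>"
proof -
  define T where "T = \<Union>\<P>"
  define \<Sigma> where "\<Sigma> = (\<Union>k\<in>T. R k \<times> C k)"
  define A0 where "A0 = restr (-\<Sigma>) A"
  have "compat R' C' k l" if "k \<in> -T" "l \<in> -T" for k l
    using compat that by (simp add: T_def)
  then obtain \<mu> where \<mu>: "\<And>z. z \<in> factors R' C' \<Longrightarrow>
      \<exists>z'. reach R' C' (-T) A0 z z' \<and> norm (A0 - fprod (-T) z') = \<mu>"
    using reach_min[of "-T" R' C' A0] by blast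
  have F': "factors R' C' \<subseteq> factors R C"
    using sub unfolding factors_def vec_on_def by blast
  \<comment> \<open>Columns in \<open>T\<close> contribute nothing off
    \<open>\<Sigma>\<close>.\<close>
  have off: "restr (-\<Sigma>) (A - fprod UNIV u) = A0 - restr (-\<Sigma>) (fprod (-T) u)"
    if u: "u \<in> factors R C" for u
  proof -
    have "fprod UNIV u = fprod T u + fprod (-T) u"
      unfolding fprod_def using sum.union_disjoint[of T "-T" "\<lambda>k. outer (fst u $ k) (snd u $ k)"]
      by simp
    moreover have "restr (-\<Sigma>) (fprod T u) = 0"
    proof -
      have "fprod T u $ i $ j = 0" if "(i, j) \<notin> \<Sigma>" for i j
        unfolding fprod_nth
      proof (rule sum.neutral, intro ballI)
        fix k assume "k \<in> T"
        then have "i \<notin> R k \<or> j \<notin> C k" using that by (auto simp: \<Sigma>_def)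
        then show "fst u $ k $ i * snd u $ k $ j = 0"
          using u by (auto simp: factors_def vec_on_def)
      qed
      then show ?thesis by (simp add: vec_eq_iff restr_nth)
    qed
    ultimately show ?thesis
      by (simp add: linear_diff[OF linear_restr] linear_add[OF linear_restr] A0_def)
  qed
  \<comment> \<open>Free columns confined to reduced rectangles contribute nothing on
    \<open>\<Sigma>\<close>.\<close>
  have off': "restr (-\<Sigma>) (fprod (-T) u) = fprod (-T) u" if u: "u \<in> factors R' C'" for u
  proof -
    have "fprod (-T) u $ i $ j = 0" if ij: "(i, j) \<in> \<Sigma>" for i j
      unfolding fprod_nth
    proof (rule sum.neutral, intro ballI)
      fix k assume "k \<in> -T"
      then have "(i, j) \<notin> R' k \<times> C' k" using rect[of k] ij by (auto simp: \<Sigma>_def T_def)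
      then show "fst u $ k $ i * snd u $ k $ j = 0"
        using u by (auto simp: factors_def vec_on_def)
    qed
    then show ?thesis by (simp add: vec_eq_iff restr_nth)
  qed
  have "\<exists>z'. reach R C UNIV A z z' \<and> norm (A - fprod UNIV z') = \<mu>" if z: "z \<in> factors R C" for z
  proof -
    obtain z1 where z1: "reach R C UNIV A z z1"
      "\<And>P. P \<in> \<P> \<Longrightarrow> spans_left R P z1 \<or> spans_right C P z1"
    proof -
      have "\<exists>z'. reach R C UNIV A z z' \<and> (\<forall>P\<in>\<P>. spans_left R P z' \<or> spans_right C P z')"
        by (rule reach_spans_all[OF z disj]) (erule (2) P, erule (1) card)
      then show thesis using that by blast
    qed
    have F1: "z1 \<in> factors R C" using reachD(2)[OF z1(1)] .
    obtain \<psi> where \<psi>: "linear \<psi>" "\<And>M. \<psi> M \<in> factors R C"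
      "\<And>M k. k \<notin> T \<Longrightarrow> fst (\<psi> M) $ k = 0 \<and> snd (\<psi> M) $ k = 0"
      "\<And>M k. fst (\<psi> M) $ k = 0 \<or> snd (\<psi> M) $ k = 0"
      "\<And>M. (\<And>i j. (i, j) \<notin> \<Sigma> \<Longrightarrow> M $ i $ j = 0) \<Longrightarrow> fprod_deriv z1 (\<psi> M) = M"
    proof -
      show thesis
      proof (rule fprod_deriv_right_inverse[OF disj, of R C z1], goal_cases)
      case (1 P k l) then show ?case by (rule P)
    next
      case (2 P) then show ?case by (rule z1(2))
    next
      case (3 \<psi>)
      from 3[folded T_def, folded \<Sigma>_def] show thesis by (rule that)
      qed
    qed
    \<comment> \<open>The correction cancels the residual on \<open>\<Sigma>\<close> by moving
      columns in \<open>T\<close> only.\<close>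
    define \<Phi> where "\<Phi> u = u + \<psi> (restr \<Sigma> (A - fprod UNIV u))" for u
    \<comment> \<open>The motions to be lifted: columns in \<open>T\<close> frozen, residual off
      \<open>\<Sigma>\<close> bounded by its value at \<open>z1\<close>. What happens on
      \<open>\<Sigma>\<close> is unrestricted, since \<open>\<Phi>\<close> repairs it.\<close>
    define S where "S = {u \<in> factors R C. (\<forall>k\<in>T. fst u $ k = fst z1 $ k \<and> snd u $ k = snd z1 $ k) \<and>
      norm (restr (-\<Sigma>) (A - fprod UNIV u)) \<le> norm (restr (-\<Sigma>) (A - fprod UNIV z1))}"
    have \<Phi>F: "\<Phi> u \<in> factors R C" if "u \<in> factors R C" for u
      unfolding \<Phi>_def using that \<psi>(2) by (rule subspace_add[OF subspace_factors])
    have lift: "A - fprod UNIV (\<Phi> u) = restr (-\<Sigma>) (A - fprod UNIV u)"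
      if u: "\<And>k. k \<in> T \<Longrightarrow> fst u $ k = fst z1 $ k \<and> snd u $ k = snd z1 $ k" for u
    proof -
      let ?M = "restr \<Sigma> (A - fprod UNIV u)"
      have "fprod UNIV (\<Phi> u) = fprod UNIV u + fprod_deriv u (\<psi> ?M)"
        using fprod_line[of UNIV "\<psi> ?M" u 1] \<psi>(4) by (simp add: \<Phi>_def fprod_deriv_def)
      \<comment> \<open>\<open>\<psi>\<close> moves only columns in \<open>T\<close>, where
        \<open>u\<close> and \<open>z1\<close> agree, so the inverse built at \<open>z1\<close> also
        serves at \<open>u\<close>.\<close>
      also have "fprod_deriv u (\<psi> ?M) = fprod_deriv z1 (\<psi> ?M)"
        unfolding fprod_deriv_def
      proof (rule sum.cong[OF refl])
        fix k
        show "outer (fst (\<psi> ?M) $ k) (snd u $ k) + outer (fst u $ k) (snd (\<psi> ?M) $ k) =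
          outer (fst (\<psi> ?M) $ k) (snd z1 $ k) + outer (fst z1 $ k) (snd (\<psi> ?M) $ k)"
          using u[of k] \<psi>(3)[of k ?M]
          by (cases "k \<in> T") (simp_all add: outer.zero_left outer.zero_right)
      qed
      also have "\<dots> = ?M"
        by (rule \<psi>(5)) (simp add: restr_nth)
      finally have "fprod UNIV (\<Phi> u) = fprod UNIV u + ?M" .
      moreover have "M - restr \<Sigma> M = restr (-\<Sigma>) M" for M :: "real^'n^'m"
        by (simp add: vec_eq_iff restr_nth)
      ultimately show ?thesis by (metis diff_diff_eq)
    qed
    have "continuous_on S \<Phi>"
      unfolding \<Phi>_def
      by (intro continuous_intros linear_continuous_on_compose[OF _ \<psi>(1)]
          linear_continuous_on_compose[OF _ linear_restr])
    moreover have "\<Phi> ` S \<subseteq> valley R C UNIV A z1"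
    proof
      fix v assume "v \<in> \<Phi> ` S"
      then obtain u where u: "u \<in> S" "v = \<Phi> u" by blast
      have "norm (A - fprod UNIV (\<Phi> u)) \<le> norm (restr (-\<Sigma>) (A - fprod UNIV z1))"
        using u(1) by (subst lift) (auto simp: S_def)
      also have "\<dots> \<le> norm (A - fprod UNIV z1)" by (rule norm_restr_le)
      finally show "v \<in> valley R C UNIV A z1"
        using u \<Phi>F by (auto simp: valley_def S_def)
    qed
    ultimately have comp: "path_component (valley R C UNIV A z1) (\<Phi> u) (\<Phi> v)"
      if "path_component S u v" for u v
      using path_component_image[OF that] by blast
    have "reach R C UNIV A z1 (\<Phi> z1)"
      unfolding \<Phi>_def
    proof (rule reach_line[OF F1 \<psi>(2)])
      show "norm (A - fprod UNIV (z1 + \<psi> (restr \<Sigma> (A - fprod UNIV z1)))) \<le> norm (A - fprod UNIV z1)"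
        using lift[of z1] norm_restr_le by (simp add: \<Phi>_def)
    qed (use \<psi>(4) in auto)
    \<comment> \<open>The free columns are cut down to their reduced rectangles, where the greedy
      descent takes place.\<close>
    define zm :: "(real^'m^'r) \<times> (real^'n^'r)"
      where "zm = (\<chi> k. proj_on (R' k) (fst z1 $ k), \<chi> k. proj_on (C' k) (snd z1 $ k))"
    have zmF': "zm \<in> factors R' C'"
      by (simp add: zm_def factors_def proj_on_mem)
    then have zmF: "zm \<in> factors R C" using F' by blast
    have zmT: "fst zm $ k = fst z1 $ k \<and> snd zm $ k = snd z1 $ k" if "k \<in> T" for k
      using F1 same[of k] that
      by (auto simp: T_def zm_def proj_on_def factors_def vec_on_def vec_eq_iff)
    have path_m: "path_component S z1 zm"
    proof (rule path_componentI[where g = "\<lambda>t. (1 - t) *\<^sub>R z1 + t *\<^sub>R zm"])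
      fix t :: real assume t: "0 \<le> t" "t \<le> 1"
      let ?u = "(1 - t) *\<^sub>R z1 + t *\<^sub>R zm"
      have uF: "?u \<in> factors R C"
        using F1 zmF by (intro subspace_add[OF subspace_factors] subspace_scale[OF subspace_factors])
      have uT: "fst ?u $ k = fst z1 $ k \<and> snd ?u $ k = snd z1 $ k" if "k \<in> T" for k
        using zmT[OF that] by (simp add: algebra_simps)
      \<comment> \<open>Off \<open>\<Sigma>\<close> an entry of a free column's product either uses
        only coordinates kept by the truncation or lies outside the rectangle and is 0.\<close>
      have "fprod (-T) ?u $ i $ j = fprod (-T) z1 $ i $ j" if ij: "(i, j) \<notin> \<Sigma>" for i j
        unfolding fprod_nth
      proof (rule sum.cong[OF refl])
        fix k assume k: "k \<in> -T"
        show "fst ?u $ k $ i * snd ?u $ k $ j = fst z1 $ k $ i * snd z1 $ k $ j"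
        proof (cases "i \<in> R' k \<and> j \<in> C' k")
          case True
          then show ?thesis by (simp add: zm_def proj_on_def algebra_simps)
        next
          case False
          then have "(i, j) \<notin> R k \<times> C k"
            using rect[of k] k ij by (auto simp: T_def \<Sigma>_def)
          then have "fst v $ k $ i * snd v $ k $ j = 0" if "v \<in> factors R C" for v
            using that by (auto simp: factors_def vec_on_def)
          from this[OF uF] this[OF F1] show ?thesis by (simp only:)
        qed
      qed
      then have "restr (-\<Sigma>) (fprod (-T) ?u) = restr (-\<Sigma>) (fprod (-T) z1)"
        by (simp add: vec_eq_iff restr_nth)
      then show "?u \<in> S"
        using uF uT off[OF uF] off[OF F1] by (simp add: S_def)
    qed (auto intro!: continuous_intros)
    then have zmS: "zm \<in> S" using path_component_mem by blast
    obtain ze where ze: "reach R' C' (-T) A0 zm ze" "norm (A0 - fprod (-T) ze) = \<mu>"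
      using \<mu>[OF zmF'] by blast
    \<comment> \<open>The greedy descent freezes the columns in \<open>T\<close> and its loss is
      exactly the residual off \<open>\<Sigma>\<close>, so it runs inside \<open>S\<close> and can
      be lifted.\<close>
    have "valley R' C' (-T) A0 zm \<subseteq> S"
    proof
      fix u assume u: "u \<in> valley R' C' (-T) A0 zm"
      then have uF': "u \<in> factors R' C'" and uF: "u \<in> factors R C"
        using F' by (auto simp: valley_def)
      have "norm (A0 - fprod (-T) u) \<le> norm (A0 - fprod (-T) zm)"
        using u by (simp add: valley_def)
      then have "norm (restr (-\<Sigma>) (A - fprod UNIV u)) \<le> norm (restr (-\<Sigma>) (A - fprod UNIV zm))"
        using off[OF uF] off'[OF uF'] off[OF zmF] off'[OF zmF'] by simp
      also have "\<dots> \<le> norm (restr (-\<Sigma>) (A - fprod UNIV z1))"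
        using zmS by (simp add: S_def)
      finally show "u \<in> S"
        using u uF zmT by (auto simp: S_def valley_def)
    qed
    then have path_e: "path_component S zm ze"
      using ze(1) path_component_of_subset unfolding reach_def by blast
    then have zeS: "ze \<in> S" using path_component_mem by blast
    have zeF': "ze \<in> factors R' C'" using reachD(2)[OF ze(1)] .
    have "path_component (valley R C UNIV A z1) z1 (\<Phi> ze)"
      using \<open>reach R C UNIV A z1 (\<Phi> z1)\<close> comp[OF path_component_trans[OF path_m path_e]]
        path_component_trans unfolding reach_def by blast
    then have "reach R C UNIV A z (\<Phi> ze)"
      using reach_trans[OF z1(1)] by (simp add: reach_def)
    moreover have "norm (A - fprod UNIV (\<Phi> ze)) = \<mu>"
      using lift[of ze] zeS off[of ze] off'[OF zeF'] ze(2) by (simp add: S_def)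
    ultimately show ?thesis by blast
  qed
  then show ?thesis by blast
qed

section \<open>From complete equivalence classes to factor pairs, and transfer to local
  valleys\<close>

theorem theorem4p13:
  fixes I :: "('m::finite \<times> 'r::finite) set"
    and J :: "('n::finite \<times> 'r) set"
    and A :: "real^'n^'m"
  assumes "\<And>k. k \<notin> CEC_union I J \<Longrightarrow> rectangular (reduced_supp I J k)"
    and "\<And>k l. k \<notin> CEC_union I J \<Longrightarrow> l \<notin> CEC_union I J \<Longrightarrow>
           reduced_supp I J k = reduced_supp I J l \<or>
           reduced_supp I J k \<inter> reduced_supp I J l = {}"
  shows "\<not> (\<exists>V. spurious_local_valley (fact_loss A) (feasible I J) V)"
proof -
  \<comment> \<open>Classes with empty support are left out: their columns need not share the same \<open>R\<close> and \<open>C\<close>.\<close>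
  define \<P> where "\<P> = {P. is_CEC I J P \<and> class_supp I J P \<noteq> {}}"
  define R where "R = col_supp I"
  define C where "C = col_supp J"
  \<comment> \<open>Using projections makes both sides empty when the reduced support is, so equal
    reduced supports always give equal sides.\<close>
  define R' where "R' k = (if k \<in> \<Union>\<P> then R k else fst ` reduced_supp I J k)" for k
  define C' where "C' k = (if k \<in> \<Union>\<P> then C k else snd ` reduced_supp I J k)" for k
  have cls: "class_supp I J P = R k \<times> C k" if "is_CEC I J P" "k \<in> P" for P k
    using class_supp_representative[of P I J k] that by (simp add: is_CEC_def rank1_supp_def R_def C_def)
  have P: "R k = R l \<and> C k = C l" if "P \<in> \<P>" "k \<in> P" "l \<in> P" for P k l
  proof -
    have "R k \<times> C k = R l \<times> C l" "R k \<times> C k \<noteq> {}"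
      using cls[of P k] cls[of P l] that by (auto simp: \<P>_def)
    then show ?thesis by (simp add: times_eq_iff)
  qed
  have \<Sigma>: "CEC_supp I J = (\<Union>k\<in>\<Union>\<P>. R k \<times> C k)"
  proof -
    have "CEC_supp I J = (\<Union>P\<in>\<P>. class_supp I J P)"
      by (auto simp: CEC_supp_def \<P>_def)
    also have "\<dots> = (\<Union>k\<in>\<Union>\<P>. R k \<times> C k)"
      by (auto simp: class_supp_def rank1_supp_def R_def C_def)
    finally show ?thesis .
  qed
  \<comment> \<open>The indices left out join the free columns with empty reduced support, where
    both hypotheses hold trivially.\<close>
  have empty: "rank1_supp I J k = {}" if k: "k \<notin> \<Union>\<P>" "k \<in> CEC_union I J" for k
  proof -
    obtain P where "is_CEC I J P" "k \<in> P" using k(2) by (auto simp: CEC_union_def)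
    with k(1) cls[of P k] show ?thesis by (auto simp: \<P>_def rank1_supp_def R_def C_def)
  qed
  have rect: "R' k \<times> C' k = reduced_supp I J k" if k: "k \<notin> \<Union>\<P>" for k
  proof -
    have "rectangular (reduced_supp I J k)"
    proof (cases "k \<in> CEC_union I J")
      case True
      with empty[OF k] have "reduced_supp I J k = {} \<times> {}" by (simp add: reduced_supp_def)
      then show ?thesis unfolding rectangular_def by blast
    qed (rule assms(1))
    then show ?thesis using k by (force simp: R'_def C'_def rectangular_def)
  qed
  have "\<exists>\<mu>. \<forall>z \<in> factors R C. \<exists>z'. reach R C UNIV A z z' \<and> norm (A - fprod UNIV z') = \<mu>"
  proof (rule reach_common_value[of \<P> R C R' C'])
    show "disjoint \<P>"
      unfolding disjoint_def
    proof (intro ballI impI)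
      fix P Q assume "P \<in> \<P>" "Q \<in> \<P>" "P \<noteq> Q"
      then show "P \<inter> Q = {}"
        using quotient_disj[OF equiv_supp_rel, of P I J Q] by (simp add: \<P>_def is_CEC_def)
    qed
    show "min (card (R k)) (card (C k)) \<le> card P" if "P \<in> \<P>" "k \<in> P" for P k
      using that by (simp add: \<P>_def is_CEC_def R_def C_def)
    show "R' k \<subseteq> R k" "C' k \<subseteq> C k" for k
      by (auto simp: R'_def C'_def R_def C_def reduced_supp_def rank1_supp_def)
    show "R' k \<times> C' k = R k \<times> C k - (\<Union>k\<in>\<Union>\<P>. R k \<times> C k)" if "k \<notin> \<Union>\<P>" for k
      using rect[OF that] by (simp add: reduced_supp_def \<Sigma> rank1_supp_def R_def C_def)
    show "compat R' C' k l" if kl: "k \<notin> \<Union>\<P>" "l \<notin> \<Union>\<P>" for k l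
    proof -
      have "reduced_supp I J k = reduced_supp I J l \<or> reduced_supp I J k \<inter> reduced_supp I J l = {}"
      proof (cases "k \<in> CEC_union I J \<or> l \<in> CEC_union I J")
        case True
        with empty kl show ?thesis by (auto simp: reduced_supp_def)
      qed (use assms(2) in blast)
      then show ?thesis
      proof
        assume "reduced_supp I J k = reduced_supp I J l"
        then show ?thesis using kl by (simp add: compat_def R'_def C'_def)
      next
        assume "reduced_supp I J k \<inter> reduced_supp I J l = {}"
        then have "(R' k \<inter> R' l) \<times> (C' k \<inter> C' l) = {}"
          using rect[OF kl(1)] rect[OF kl(2)] by (metis Times_Int_Times)
        then show ?thesis by (simp add: compat_def)
      qed
    qed
    show "R k = R l \<and> C k = C l" if "P \<in> \<P>" "k \<in> P" "l \<in> P" for P k l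
      using that by (rule P)
    show "R' k = R k \<and> C' k = C k" if "k \<in> \<Union>\<P>" for k
      using that by (simp only: R'_def C'_def if_True)
  qed
  then obtain \<mu> where \<mu>: "\<And>z. z \<in> factors R C \<Longrightarrow>
      \<exists>z'. reach R C UNIV A z z' \<and> norm (A - fprod UNIV z') = \<mu>" by blast
  \<comment> \<open>Transposing both factors returns from column-first storage to the feasible set
    and carries paths over.\<close>
  define \<tau> :: "(real^'m^'r) \<times> (real^'n^'r) \<Rightarrow> (real^'r^'m) \<times> (real^'r^'n)"
    where "\<tau> z = (transpose (fst z), transpose (snd z))" for z
  have loss: "fact_loss A (\<tau> z) = (norm (A - fprod UNIV z))\<^sup>2" for z
  proof -
    have "transpose (fst z) ** transpose (transpose (snd z)) = fprod UNIV z"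
      by (simp add: vec_eq_iff fprod_nth matrix_matrix_mult_def transpose_def)
    then show ?thesis by (simp add: fact_loss_def \<tau>_def)
  qed
  have feas: "\<tau> z \<in> feasible I J \<longleftrightarrow> z \<in> factors R C" for z
    by (auto simp: \<tau>_def feasible_def supp_def factors_def vec_on_def R_def C_def col_supp_def
        transpose_def)
  have surj: "\<exists>z. w = \<tau> z" for w
    by (rule exI[of _ "(transpose (fst w), transpose (snd w))"]) (simp add: \<tau>_def transpose_transpose)
  have cont: "continuous_on S \<tau>" for S
    unfolding \<tau>_def transpose_def by (intro continuous_intros continuous_on_vec_lambda)
  have "\<exists>x\<in>V. is_arg_min (fact_loss A) (\<lambda>z. z \<in> feasible I J) x"
    if "local_valley (fact_loss A) (feasible I J) V" for V
  proof -
    obtain \<alpha> x where x: "x \<in> feasible I J" "fact_loss A x \<le> \<alpha>"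
      and V: "V = path_component_set {x \<in> feasible I J. fact_loss A x \<le> \<alpha>} x"
      using \<open>local_valley (fact_loss A) (feasible I J) V\<close> unfolding local_valley_def by blast
    obtain z where z: "x = \<tau> z" using surj by blast
    with x(1) feas have "z \<in> factors R C" by simp
    with \<mu> obtain z' where z': "reach R C UNIV A z z'" "norm (A - fprod UNIV z') = \<mu>" by blast
    have "\<tau> ` valley R C UNIV A z \<subseteq> {x \<in> feasible I J. fact_loss A x \<le> \<alpha>}"
    proof
      fix w assume "w \<in> \<tau> ` valley R C UNIV A z"
      then obtain u where u: "w = \<tau> u" "u \<in> factors R C"
        "norm (A - fprod UNIV u) \<le> norm (A - fprod UNIV z)" by (auto simp: valley_def)
      then have "fact_loss A w \<le> fact_loss A x"
        unfolding u(1) z loss by (intro power_mono) auto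
      with x(2) u feas show "w \<in> {x \<in> feasible I J. fact_loss A x \<le> \<alpha>}" by simp
    qed
    then have "\<tau> z' \<in> V"
      using path_component_image[OF z'(1)[unfolded reach_def] cont] by (simp add: V z)
    \<comment> \<open>Every feasible point descends to the value \<mu>, so none lies below
      it.\<close>
    moreover have "is_arg_min (fact_loss A) (\<lambda>z. z \<in> feasible I J) (\<tau> z')"
      unfolding is_arg_min_linorder
    proof (intro conjI allI impI)
      show "\<tau> z' \<in> feasible I J" using feas reachD(2)[OF z'(1)] by simp
      fix w assume w: "w \<in> feasible I J"
      obtain u where u: "w = \<tau> u" using surj by blast
      with w feas have "u \<in> factors R C" by simp
      with \<mu> obtain u' where u': "reach R C UNIV A u u'" "norm (A - fprod UNIV u') = \<mu>" by blast
      have "\<mu> \<le> norm (A - fprod UNIV u)" using reachD(3)[OF u'(1)] u'(2) by simp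
      then show "fact_loss A (\<tau> z') \<le> fact_loss A w"
        unfolding u loss z'(2)[symmetric] by (intro power_mono) auto
    qed
    ultimately show ?thesis by blast
  qed
  then show ?thesis unfolding spurious_local_valley_def by blast
qed

end
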